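(* Let $r>1$ and let $(T_1,T_2)$ be a commuting pair of invertible bounded operators on a complex Hilbert space with $\|T_j\|\le r$ and $\|T_j^{-1}\|\le r$ for $j=1,2$. Then $$\|g(T_1,T_2)\|\le\left[4+4\left(\frac{r^2+1}{r^2-1}\right)^{1/2}+\left(\frac{r^2+1}{r^2-1}\right)^2\right]\|g\|_{\infty,\overline{\mathbb{A}}_r^2}$$ for all $g\in\mathrm{Rat}(\overline{\mathbb{A}}_r^2)$.
   Context: $\mathbb{A}_r=\{z\in\mathbb{C}: r^{-1}<|z|<r\}$, $\overline{\mathbb{A}}_r$ is its closure, and $\overline{\mathbb{A}}_r^2=\overline{\mathbb{A}}_r\times\overline{\mathbb{A}}_r$. For a compact set $X\subseteq\mathbb{C}^n$, $\mathrm{Rat}(X)$ is the algebra of rational functions $p/q$ with singularities outside $X$ (i.e. $q$ has no zeros in $X$), and $\|g\|_{\infty,X}=\sup_{X}|g|$. For a commuting tuple $\underline T$ with Taylor joint spectrum in $X$ and $g=p/q\in\mathrm{Rat}(X)$, $g(\underline T)=p(\underline T)q(\underline T)^{-1}$. The hypotheses imply that the Taylor joint spectrum of $(T_1,T_2)$ lies in $\overline{\mathbb{A}}_r^2$. *)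

theory Defs
  imports "HOL-Analysis.Analysis" "HOL-Computational_Algebra.Polynomial"
begin

text \<open>
  Complex Hilbert spaces. HOL-Analysis only has real inner products, so the complex scalar
  multiplication and the sesquilinear product (linear in the first argument) are added on top of
  a real Hilbert space whose inner product is the real part of the complex one. In particular
  the norm, and hence the operator norm on \<^typ>\<open>'a \<Rightarrow>\<^sub>L 'a\<close>, is the usual one.
\<close>

class complex_hilbert_space = real_inner + banach +
  fixes scaleC :: "complex \<Rightarrow> 'a \<Rightarrow> 'a" (infixr \<open>*c\<close> 75)
    and cinner :: "'a \<Rightarrow> 'a \<Rightarrow> complex"
  assumes scaleC_add_right: "c *c (x + y) = c *c x + c *c y"
    and scaleC_add_left: "(c + d) *c x = c *c x + d *c x"
    and scaleC_scaleC: "c *c d *c x = (c * d) *c x"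
    and scaleC_of_real: "complex_of_real t *c x = t *\<^sub>R x"
    and cinner_commute: "cinner x y = cnj (cinner y x)"
    and cinner_add_left: "cinner (x + y) z = cinner x z + cinner y z"
    and cinner_scaleC_left: "cinner (c *c x) y = c * cinner x y"
    and inner_eq_Re_cinner: "inner x y = Re (cinner x y)"

instantiation complex :: complex_hilbert_space
begin

definition scaleC_complex :: "complex \<Rightarrow> complex \<Rightarrow> complex"
  where "scaleC_complex c x = c * x"

definition cinner_complex :: "complex \<Rightarrow> complex \<Rightarrow> complex"
  where "cinner_complex x y = x * cnj y"

instance
  by standard
    (auto simp: scaleC_complex_def cinner_complex_def algebra_simps scaleR_conv_of_real
       inner_complex_def)

end

lemma norm_scaleC: "norm (c *c x) = cmod c * norm (x :: 'a :: complex_hilbert_space)"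
proof -
  have "cinner (c *c x) (c *c x) = c * (cnj c * cinner x x)"
    by (metis cinner_commute cinner_scaleC_left complex_cnj_mult)
  also have "\<dots> = complex_of_real ((cmod c)\<^sup>2) * cinner x x"
    by (simp only: complex_norm_square mult.assoc)
  finally have "inner (c *c x) (c *c x) = (cmod c)\<^sup>2 * inner x x"
    by (simp add: inner_eq_Re_cinner)
  then show ?thesis
    by (simp add: norm_eq_sqrt_inner real_sqrt_mult)
qed

text \<open>
  Elements of \<^typ>\<open>'a \<Rightarrow>\<^sub>L 'a\<close> are bounded \<^emph>\<open>real\<close>-linear maps; the bounded operators on the
  complex Hilbert space are those satisfying the following predicate.
\<close>

definition clinear_op :: "('a :: complex_hilbert_space \<Rightarrow>\<^sub>L 'a) \<Rightarrow> bool"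
  where "clinear_op T \<longleftrightarrow> (\<forall>c x. blinfun_apply T (c *c x) = c *c blinfun_apply T x)"

lift_definition scalar_op :: "complex \<Rightarrow> 'a :: complex_hilbert_space \<Rightarrow>\<^sub>L 'a" is "\<lambda>c x. c *c x"
proof
  fix c t and x y :: 'a
  show "c *c (x + y) = c *c x + c *c y"
    by (rule scaleC_add_right)
  show "c *c t *\<^sub>R x = t *\<^sub>R c *c x"
    by (metis scaleC_of_real scaleC_scaleC mult.commute)
  show "\<exists>K. \<forall>x :: 'a. norm (c *c x) \<le> norm x * K"
    by (metis norm_scaleC mult.commute order_refl)
qed

definition op_power :: "('a :: real_normed_vector \<Rightarrow>\<^sub>L 'a) \<Rightarrow> nat \<Rightarrow> ('a \<Rightarrow>\<^sub>L 'a)"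
  where "op_power T n = ((\<lambda>S. T o\<^sub>L S) ^^ n) id_blinfun"

definition is_op_inverse :: "('a :: real_normed_vector \<Rightarrow>\<^sub>L 'a) \<Rightarrow> ('a \<Rightarrow>\<^sub>L 'a) \<Rightarrow> bool"
  where "is_op_inverse T S \<longleftrightarrow> T o\<^sub>L S = id_blinfun \<and> S o\<^sub>L T = id_blinfun"

text \<open>The inverse of a complex-linear operator is automatically complex-linear.\<close>

definition invertible_op :: "('a :: real_normed_vector \<Rightarrow>\<^sub>L 'a) \<Rightarrow> bool"
  where "invertible_op T \<longleftrightarrow> (\<exists>S. is_op_inverse T S)"

definition op_inverse :: "('a :: real_normed_vector \<Rightarrow>\<^sub>L 'a) \<Rightarrow> ('a \<Rightarrow>\<^sub>L 'a)"
  where "op_inverse T = (THE S. is_op_inverse T S)"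

lemma op_inverse_eq: "is_op_inverse T S \<Longrightarrow> op_inverse T = S"
  unfolding op_inverse_def
proof (rule the_equality)
  fix S' assume *: "is_op_inverse T S" "is_op_inverse T S'"
  have "S' = S' o\<^sub>L (T o\<^sub>L S)"
    using * by (simp add: is_op_inverse_def blinfun_eqI)
  also have "\<dots> = (S' o\<^sub>L T) o\<^sub>L S"
    by (simp add: blinfun_eqI)
  also have "\<dots> = S"
    using * by (simp add: is_op_inverse_def blinfun_eqI)
  finally show "S' = S" .
qed

text \<open>
  A polynomial \<open>p(z, w)\<close> in two variables is a \<^typ>\<open>complex poly poly\<close>, where
  \<open>coeff (coeff p i) j\<close> is the coefficient of \<open>z\<^sup>i w\<^sup>j\<close>; see \<open>eval2_eq_sum\<close>.
\<close>

definition eval2 :: "complex poly poly \<Rightarrow> complex \<times> complex \<Rightarrow> complex"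
  where "eval2 p x = poly (poly p [:fst x:]) (snd x)"

lemma eval2_eq_sum:
  "eval2 p (z, w) =
     (\<Sum>i\<le>degree p. \<Sum>j\<le>degree (coeff p i). coeff (coeff p i) j * z ^ i * w ^ j)"
  unfolding eval2_def
  by (simp add: poly_altdef[of p] poly_sum poly_power)
    (simp add: poly_altdef sum_distrib_left mult_ac)

definition eval2_op ::
    "complex poly poly \<Rightarrow> ('a :: complex_hilbert_space \<Rightarrow>\<^sub>L 'a) \<Rightarrow> ('a \<Rightarrow>\<^sub>L 'a) \<Rightarrow> ('a \<Rightarrow>\<^sub>L 'a)"
  where "eval2_op p T1 T2 =
    (\<Sum>i\<le>degree p. \<Sum>j\<le>degree (coeff p i).
       scalar_op (coeff (coeff p i) j) o\<^sub>L op_power T1 i o\<^sub>L op_power T2 j)"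

text \<open>
  An element \<open>p/q\<close> of \<open>Rat(X)\<close> is given by a pair \<open>(p, q)\<close> with \<open>q\<close> zero-free on \<open>X\<close>. Pairs
  representing the same rational function are not identified, so a statement about all pairs is
  a statement about all rational functions and all their admissible representations.
\<close>

definition Rat :: "(complex \<times> complex) set \<Rightarrow> (complex poly poly \<times> complex poly poly) set"
  where "Rat X = {(p, q). \<forall>x\<in>X. eval2 q x \<noteq> 0}"

fun rat_eval :: "complex poly poly \<times> complex poly poly \<Rightarrow> complex \<times> complex \<Rightarrow> complex"
  where "rat_eval (p, q) x = eval2 p x / eval2 q x"

fun rat_op :: "complex poly poly \<times> complex poly poly
    \<Rightarrow> ('a :: complex_hilbert_space \<Rightarrow>\<^sub>L 'a) \<Rightarrow> ('a \<Rightarrow>\<^sub>L 'a) \<Rightarrow> ('a \<Rightarrow>\<^sub>L 'a)"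
  where "rat_op (p, q) T1 T2 = eval2_op p T1 T2 o\<^sub>L op_inverse (eval2_op q T1 T2)"

definition sup_norm :: "'b set \<Rightarrow> ('b \<Rightarrow> complex) \<Rightarrow> real"
  where "sup_norm X f = (SUP x\<in>X. cmod (f x))"

definition annulus :: "real \<Rightarrow> complex set"
  where "annulus r = {z. inverse r < cmod z \<and> cmod z < r}"

end

theory Submission
  imports Defs "HOL-Complex_Analysis.Cauchy_Integral_Formula" "HOL-Library.Function_Algebras"
    "HOL-Computational_Algebra.Fundamental_Theorem_Algebra"
begin

text \<open>
  Write \<open>s = (r\<^sup>2 + 1) / (r\<^sup>2 - 1)\<close>. The bound that comes out is \<open>(2 + sqrt s)\<^sup>2 = 4 + 4 sqrt s + s\<close>,
  and \<open>s \<le> s\<^sup>2\<close> because \<open>s \<ge> 1\<close>.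

  Suppose first that \<open>g = \<Sum> a(m,n) z\<^sup>m w\<^sup>n\<close> is a Laurent polynomial. It splits into four parts
  according to the signs of \<open>m\<close> and \<open>n\<close>, where the terms with index \<open>0\<close> are shared equally between
  the two signs. The part with nonnegative exponents is a polynomial in the commuting
  operators \<open>T\<^sub>1, T\<^sub>2\<close>, the other three are polynomials in the pairs in which one or both operators
  are replaced by their inverses. All these operators have norm at most \<open>r\<close>, so by Ando's
  inequality (\<open>ando_inequality\<close>) each part is bounded by its supremum on the torus
  \<open>|z| = |w| = r\<close>. That supremum is at most \<open>(1 + sqrt s / 2)\<^sup>2\<close> times the supremum of
  \<open>g\<close>: in one variable, the analytic part differs from \<open>g\<close> on \<open>|z| = r\<close> by the other part, whose
  coefficients are square summable with weights \<open>r\<^sup>2\<^sup>n\<close> by Bessel's inequality on the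
  circle \<open>|z| = 1/r\<close> (\<open>analytic_part_bound\<close>); two variables are treated one after the other. Summing the
  four parts gives \<open>4 (1 + sqrt s / 2)\<^sup>2 = (2 + sqrt s)\<^sup>2\<close> (\<open>laurent_bound\<close>).

  A rational function \<open>p/q\<close> is reduced to this case by approximating \<open>1/q\<close> uniformly on the
  closed biannulus by Laurent polynomials \<open>g\<^sub>n\<close> (\<open>approximable_inverse\<close>): Cauchy's formula on a slightly larger
  annulus in the first variable is a uniform limit of Riemann sums, whose terms are products
  of factors \<open>1/(a - z)\<close> and \<open>1/(b - w)\<close> with \<open>a, b\<close> off the annulus, each of them a geometric series. The estimate for Laurent
  polynomials turns uniform convergence into norm convergence of the operators \<open>g\<^sub>n(T)\<close>; their
  limit inverts \<open>q(T)\<close>, and the bound passes to the limit.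

  Ando's inequality itself is proved by finite means. For commuting contractions \<open>S\<^sub>1, S\<^sub>2\<close> put
  \<open>q\<^sub>i(x) = \<parallel>x\<parallel>\<^sup>2 - \<parallel>S\<^sub>i x\<parallel>\<^sup>2\<close>. The map \<open>(x, S\<^sub>1 x) \<mapsto> (S\<^sub>2 x, x)\<close> preserves the value of
  \<open>q\<^sub>1 \<oplus> q\<^sub>2\<close> and therefore extends, through the orthogonal projection onto the graph of \<open>S\<^sub>1\<close>, to a contraction.
  Iterating it as the transition map of a discrete-time system lifts \<open>S\<^sub>2\<close> to a
  contraction on finite sequences of vectors, on which \<open>S\<^sub>1\<close> acts as a shift. The shift is
  diagonalised by roots of unity, and what remains is von Neumann's inequality for one contraction
  (\<open>von_neumann_inequality\<close>), a consequence of the positivity of Toeplitz forms.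
\<close>

section \<open>Complex inner products and the Lax--Milgram lemma\<close>

lemma scaleC_zero_left [simp]: "0 *c x = (0 :: 'a :: complex_hilbert_space)"
  using scaleC_of_real[of 0 x] by simp

lemma scaleC_one [simp]: "1 *c x = (x :: 'a :: complex_hilbert_space)"
  using scaleC_of_real[of 1 x] by simp

lemma cinner_zero_left [simp]: "cinner 0 y = (0 :: complex)"
  using cinner_add_left[of 0 0 y] by simp

lemma cinner_add_right: "cinner x (y + z) = cinner x y + cinner x z"
  by (metis cinner_add_left cinner_commute complex_cnj_add)

lemma cinner_scaleC_right: "cinner x (c *c y) = cnj c * cinner x y"
  by (metis cinner_commute cinner_scaleC_left complex_cnj_mult)

lemma cinner_zero_right [simp]: "cinner x 0 = (0 :: complex)"
  using cinner_add_right[of x 0 0] by simp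

lemma cinner_sum_left: "cinner (\<Sum>i\<in>A. f i) y = (\<Sum>i\<in>A. cinner (f i) y)"
  by (induction A rule: infinite_finite_induct) (auto simp: cinner_add_left)

lemma Re_cinner_self: "Re (cinner x x) = (norm x)\<^sup>2"
  by (metis inner_eq_Re_cinner power2_norm_eq_inner)

lemma inner_scaleC: "inner (c *c x) y = inner x (cnj c *c y)"
  by (simp add: inner_eq_Re_cinner cinner_scaleC_left cinner_scaleC_right)

lemma cinner_self: "cinner x x = complex_of_real ((norm x)\<^sup>2)"
proof -
  have "Im (cinner x x) = 0"
    using arg_cong[OF cinner_commute[of x x], of Im] by simp
  then show ?thesis
    by (intro complex_eqI) (simp_all add: Re_cinner_self)
qed

text \<open>
  The Lax--Milgram lemma for a symmetric form. The vector sought minimises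
  \<open>a(x,x) - 2 f(x)\<close>: coercivity bounds this functional from below, the parallelogram law makes every
  minimising sequence Cauchy, and the first variation at the minimiser vanishes.
\<close>

lemma coercive_form_represents:
  fixes a :: "'a :: {real_inner, banach} \<Rightarrow> 'a \<Rightarrow> real"
  assumes "bounded_bilinear a" and sym: "\<And>x y. a x y = a y x"
    and "c > 0" and coer: "\<And>x. c * (norm x)\<^sup>2 \<le> a x x"
    and "bounded_linear f"
  shows "\<exists>!l. \<forall>k. a l k = f k"
proof -
  interpret a: bounded_bilinear a by fact
  interpret f: bounded_linear f by fact
  define J where "J x = a x x - 2 * f x" for x
  obtain B where B: "\<And>x. norm (f x) \<le> norm x * B"
    using f.bounded by blast
  have J_ge: "J x \<ge> - (B\<^sup>2 / c)" for x
  proof -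
    have "c * (norm x)\<^sup>2 - 2 * (norm x * B) \<le> J x"
      using coer[of x] B[of x] by (auto simp: J_def abs_le_iff)
    moreover have "c * (norm x)\<^sup>2 - 2 * (norm x * B) + B\<^sup>2 / c = (c * norm x - B)\<^sup>2 / c"
      using \<open>c > 0\<close> by (simp add: field_simps power2_eq_square)
    moreover have "(c * norm x - B)\<^sup>2 / c \<ge> 0"
      using \<open>c > 0\<close> by simp
    ultimately show ?thesis by linarith
  qed
  define d where "d = Inf (range J)"
  have bdd: "bdd_below (range J)"
    using J_ge by (auto simp: bdd_below_def)
  have d_le: "d \<le> J x" for x
    unfolding d_def by (rule cInf_lower[OF _ bdd]) simp
  have par: "c * (norm (x - y))\<^sup>2 \<le> 2 * J x + 2 * J y - 4 * d" for x y
  proof -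
    have "a (x - y) (x - y) = 2 * J x + 2 * J y - 4 * J ((1/2) *\<^sub>R (x + y))"
      using sym[of x y]
      by (simp add: J_def a.diff_left a.diff_right a.add_left a.add_right a.scaleR_left a.scaleR_right
          f.add f.scaleR algebra_simps)
    then show ?thesis
      using coer[of "x - y"] d_le[of "(1/2) *\<^sub>R (x + y)"] by linarith
  qed
  have "\<exists>x. J x < d + 1 / Suc n" for n
  proof -
    have "Inf (range J) < d + 1 / Suc n"
      by (simp add: d_def)
    then show ?thesis
      using cInf_lessD[of "range J" "d + 1 / Suc n"] by auto
  qed
  then obtain X where X: "\<And>n. J (X n) < d + 1 / Suc n"
    by metis
  have "Cauchy X"
  proof (rule metric_CauchyI)
    fix e :: real assume "e > 0"
    obtain M :: nat where M: "4 / (c * e\<^sup>2) < M"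
      using reals_Archimedean2 by blast
    have "dist (X m) (X n) < e" if "m \<ge> M" "n \<ge> M" for m n
    proof -
      have "0 < 4 / (c * e\<^sup>2)"
        using \<open>c > 0\<close> \<open>e > 0\<close> by simp
      then have M0: "M > 0"
        using M by linarith
      have small: "1 / Suc k \<le> 1 / M" if "k \<ge> M" for k
        using that M0 by (intro divide_left_mono) auto
      have "c * (norm (X m - X n))\<^sup>2 \<le> 2 * J (X m) + 2 * J (X n) - 4 * d"
        by (rule par)
      also have "\<dots> < 4 * (1 / M)"
        using X[of m] X[of n] small[OF that(1)] small[OF that(2)] by argo
      also have "\<dots> < c * e\<^sup>2"
        using M M0 \<open>c > 0\<close> \<open>e > 0\<close> by (simp add: field_simps)
      finally have "(norm (X m - X n))\<^sup>2 < e\<^sup>2"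
        using \<open>c > 0\<close> by simp
      then show ?thesis
        using \<open>e > 0\<close> by (simp add: dist_norm power2_less_imp_less)
    qed
    then show "\<exists>M. \<forall>m\<ge>M. \<forall>n\<ge>M. dist (X m) (X n) < e"
      by blast
  qed
  then obtain l where l: "X \<longlonglongrightarrow> l"
    using Cauchy_convergent_iff convergent_def by blast
  have "(\<lambda>n. J (X n)) \<longlonglongrightarrow> J l"
    unfolding J_def by (intro tendsto_intros a.tendsto f.tendsto l)
  moreover have "(\<lambda>n. d + 1 / Suc n) \<longlonglongrightarrow> d + 0"
    by (intro tendsto_intros LIMSEQ_Suc[OF lim_1_over_n])
  ultimately have "J l \<le> d"
    using X by (intro LIMSEQ_le[of "\<lambda>n. J (X n)" "J l" "\<lambda>n. d + 1 / Suc n"]) (auto intro: less_imp_le)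
  then have J_min: "J l \<le> J x" for x
    using d_le[of x] by linarith
  have ex: "a l k = f k" for k
  proof (rule ccontr)
    assume "a l k \<noteq> f k"
    define g where "g = a l k - f k"
    have ak: "0 \<le> a k k"
      using coer[of k] \<open>c > 0\<close> by (meson mult_nonneg_nonneg less_imp_le order_trans zero_le_power2)
    (* A step along k of this length decreases J; the summand 1 avoids a division by zero. *)
    define t where "t = - g / (a k k + 1)"
    have "J (l + t *\<^sub>R k) = J l + 2 * t * g + t\<^sup>2 * a k k"
      using sym[of l k]
      by (simp add: J_def g_def a.add_left a.add_right a.scaleR_left a.scaleR_right f.add f.scaleR
          algebra_simps power2_eq_square)
    then have "0 \<le> 2 * t * g + t\<^sup>2 * a k k"
      using J_min[of "l + t *\<^sub>R k"] by linarith
    also have "t\<^sup>2 * a k k \<le> t\<^sup>2 * (a k k + 1)"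
      by (intro mult_left_mono) auto
    also have "2 * t * g + t\<^sup>2 * (a k k + 1) = - (g\<^sup>2 / (a k k + 1))"
    proof -
      have "t * (a k k + 1) = - g"
        using ak by (simp add: t_def)
      then have "t\<^sup>2 * (a k k + 1) = t * (- g)"
        by (simp add: power2_eq_square mult.assoc)
      moreover have "t * g = - (g\<^sup>2 / (a k k + 1))"
        by (simp add: t_def power2_eq_square)
      ultimately show ?thesis by simp
    qed
    finally have "g\<^sup>2 / (a k k + 1) \<le> 0" by simp
    moreover have "g\<^sup>2 / (a k k + 1) > 0"
      using \<open>a l k \<noteq> f k\<close> ak by (simp add: g_def)
    ultimately show False by linarith
  qed
  have "l' = l" if "\<forall>k. a l' k = f k" for l'
  proof -
    have "a (l' - l) (l' - l) = 0"
      using that ex by (simp add: a.diff_left)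
    then have "c * (norm (l' - l))\<^sup>2 \<le> 0"
      using coer[of "l' - l"] by simp
    then show ?thesis
      using \<open>c > 0\<close> by (simp add: mult_le_0_iff)
  qed
  then show ?thesis
    using ex by blast
qed

section \<open>Averages over roots of unity and contractions for semi-inner products\<close>

lemma sum_roots_of_unity:
  fixes k :: int and M :: nat
  assumes "\<bar>k\<bar> < int M"
  shows "(\<Sum>t<M. cis (2 * pi * real t / real M) powi k) = (if k = 0 then of_nat M else 0)"
proof (cases "k = 0")
  case False
  define \<omega> where "\<omega> = cis (2 * pi * of_int k / real M)"
  have M: "M > 0" using assms by simp
  have pow: "cis (2 * pi * real t / real M) powi k = \<omega> ^ t" for t
  proof -
    have "\<omega> ^ t = cis (real t * (2 * pi * of_int k / real M))"
      unfolding \<omega>_def by (rule Complex.DeMoivre)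
    also have "real t * (2 * pi * of_int k / real M) = of_int k * (2 * pi * real t / real M)"
      by simp
    finally show ?thesis
      by (simp only: cis_power_int)
  qed
  have "\<omega> ^ M = 1"
    using M by (simp add: \<omega>_def Complex.DeMoivre cis_multiple_2pi)
  moreover have "\<omega> \<noteq> 1"
  proof
    assume "\<omega> = 1"
    then have "cos (2 * pi * of_int k / real M) = 1"
      by (metis \<omega>_def cis.sel(1) one_complex.sel(1))
    then obtain j :: int where "2 * pi * of_int k / real M = of_int j * 2 * pi"
      using cos_one_2pi_int by blast
    then have "real_of_int k = of_int (j * int M)"
      using M by (simp add: field_simps)
    then have k: "k = j * int M"
      by (simp only: of_int_eq_iff)
    then have "\<bar>k\<bar> = \<bar>j\<bar> * int M" "j \<noteq> 0"
      using False by (auto simp: abs_mult)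
    then have "\<bar>k\<bar> \<ge> 1 * int M"
      by (simp only:) (intro mult_right_mono, auto)
    then show False using assms by simp
  qed
  ultimately have "(\<Sum>t<M. \<omega> ^ t) = 0"
    by (simp add: geometric_sum)
  then show ?thesis
    using False by (simp add: pow)
qed auto

lemma sum_roots_of_unity_diff:
  fixes a b M :: nat
  assumes "a < b + M" "b < a + M"
  shows "(\<Sum>t<M. cis (2 * pi * real t / real M) ^ a * cnj (cis (2 * pi * real t / real M)) ^ b)
    = (if a = b then of_nat M else 0)"
proof -
  have *: "cis x ^ a * cnj (cis x) ^ b = cis x powi (int a - int b)" for x
    by (simp add: cis_power_int Complex.DeMoivre cis_cnj cis_mult algebra_simps)
  have "\<bar>int a - int b\<bar> < int M"
    using assms by linarith
  then show ?thesis
    unfolding * by (subst sum_roots_of_unity) auto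
qed

text \<open>
  Averaging over a finite stretch of a shift counts the term of shift \<open>k\<close> only \<open>N - k\<close> times. These
  Fejer weights, divided by \<open>N\<close>, tend to 1, so a bound that is uniform in \<open>N\<close> survives
  without them.
\<close>

lemma fejer_limit:
  fixes d :: "'i \<Rightarrow> complex" and \<kappa> :: "'i \<Rightarrow> nat"
  assumes "\<And>N. N > 0 \<Longrightarrow> 2 * cmod (\<Sum>j\<in>A. of_nat (N - \<kappa> j) * d j) \<le> real N * K"
  shows "2 * cmod (\<Sum>j\<in>A. d j) \<le> K"
proof (rule LIMSEQ_le_const2)
  have lim: "(\<lambda>N. of_nat (N - j) / of_nat N :: complex) \<longlonglongrightarrow> 1" for j :: nat
  proof -
    have "(\<lambda>N. 1 - of_nat j / of_nat N :: complex) \<longlonglongrightarrow> 1 - 0"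
      by (intro tendsto_diff tendsto_const lim_const_over_n)
    moreover have "\<forall>\<^sub>F N in sequentially. (1 - of_nat j / of_nat N :: complex) = of_nat (N - j) / of_nat N"
      using eventually_ge_at_top[of "Suc j"]
      by eventually_elim (simp add: of_nat_diff diff_divide_distrib)
    ultimately show ?thesis
      by (simp add: tendsto_cong)
  qed
  have "(\<lambda>N. 2 * cmod (\<Sum>j\<in>A. of_nat (N - \<kappa> j) / of_nat N * d j)) \<longlonglongrightarrow> 2 * cmod (\<Sum>j\<in>A. 1 * d j)"
    by (intro tendsto_intros lim)
  then show "(\<lambda>N. 2 * cmod (\<Sum>j\<in>A. of_nat (N - \<kappa> j) / of_nat N * d j)) \<longlonglongrightarrow> 2 * cmod (\<Sum>j\<in>A. d j)"
    by simp
  have "2 * cmod (\<Sum>j\<in>A. of_nat (N - \<kappa> j) / of_nat N * d j) \<le> K" if "N > 0" for N :: nat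
  proof -
    have *: "(\<Sum>j\<in>A. of_nat (N - \<kappa> j) / of_nat N * d j) = (\<Sum>j\<in>A. of_nat (N - \<kappa> j) * d j) / of_nat N"
      by (simp add: sum_divide_distrib)
    show ?thesis
      unfolding * using assms[OF that] that by (simp add: norm_divide divide_le_eq mult.commute)
  qed
  then show "\<exists>N. \<forall>n\<ge>N. 2 * cmod (\<Sum>j\<in>A. of_nat (n - \<kappa> j) / of_nat n * d j) \<le> K"
    by (intro exI[of _ 1]) auto
qed

text \<open>
  A positive semidefinite sesquilinear form. Degenerate forms are essential: the forms used below,
  \<open>\<parallel>x\<parallel>\<^sup>2 - \<parallel>S x\<parallel>\<^sup>2\<close> and the Fejer forms, may vanish on nonzero vectors. The scalar multiplication is a
  parameter, since the spaces of sequences to which the locale is applied carry no complex structure of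
  their own.
\<close>

locale semi_inner =
  fixes B :: "'v :: ab_group_add \<Rightarrow> 'v \<Rightarrow> complex" and sc :: "complex \<Rightarrow> 'v \<Rightarrow> 'v"
  assumes add_left: "B (x + y) z = B x z + B y z"
    and sc_left: "B (sc c x) y = c * B x y"
    and commute: "B x y = cnj (B y x)"
    and nonneg: "0 \<le> Re (B x x)"
begin

lemma zero_left [simp]: "B 0 y = 0"
  using add_left[of 0 0 y] by simp

lemma diff_left: "B (x - y) z = B x z - B y z"
  using add_left[of "x - y" y z] by simp

lemma add_right: "B x (y + z) = B x y + B x z"
  by (metis add_left commute complex_cnj_add)

lemma diff_right: "B x (y - z) = B x y - B x z"
  by (metis diff_left commute complex_cnj_diff)

lemma sc_right: "B x (sc c y) = cnj c * B x y"
  by (metis sc_left commute complex_cnj_mult)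

lemma sum_left: "B (\<Sum>i\<in>A. f i) y = (\<Sum>i\<in>A. B (f i) y)"
  by (induction A rule: infinite_finite_induct) (auto simp: add_left)

lemma sum_right: "B x (\<Sum>i\<in>A. f i) = (\<Sum>i\<in>A. B x (f i))"
  by (subst commute, subst sum_left) (simp add: commute[symmetric])

text \<open>
  The Cauchy--Schwarz inequality in its additive form. It involves no square roots, so it can be summed over
  a family of forms directly; the multiplicative form is recovered at the very end by
  scaling.
\<close>

lemma norm_le: "2 * cmod (B x y) \<le> Re (B x x) + Re (B y y)"
proof -
  (* A phase that turns B x y into its modulus, so that expanding B (u x - y) (u x - y) >= 0 gives the claim. *)
  define u where "u = cnj (sgn (B x y))"
  have uB: "u * B x y = of_real (cmod (B x y))"
    using complex_norm_square[of "B x y"]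
    by (cases "B x y = 0") (auto simp: u_def sgn_eq field_simps power2_eq_square)
  have uu: "Re (u * cnj u * B x x) \<le> Re (B x x)"
  proof -
    have "cmod u \<le> 1"
      by (simp add: u_def norm_sgn)
    moreover have "u * cnj u = of_real ((cmod u)\<^sup>2)"
      by (rule complex_norm_square[symmetric])
    ultimately show ?thesis
      using nonneg[of x] by (simp add: mult_left_le_one_le power_le_one del: of_real_power)
  qed
  have "0 \<le> Re (B (sc u x - y) (sc u x - y))"
    by (rule nonneg)
  also have "B (sc u x - y) (sc u x - y) = u * cnj u * B x x + B y y - (u * B x y + cnj (u * B x y))"
    using commute[of y x] by (simp add: diff_left diff_right sc_left sc_right algebra_simps)
  also have "Re \<dots> = Re (u * cnj u * B x x) + Re (B y y) - 2 * cmod (B x y)"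
    unfolding uB by simp
  finally show ?thesis using uu by linarith
qed

end

locale semi_contraction = semi_inner B sc
  for B :: "'v :: ab_group_add \<Rightarrow> 'v \<Rightarrow> complex" and sc :: "complex \<Rightarrow> 'v \<Rightarrow> 'v" +
  fixes T :: "'v \<Rightarrow> 'v"
  assumes T_add: "T (x + y) = T x + T y"
    and T_sc: "T (sc c x) = sc c (T x)"
    and contr: "Re (B (T x) (T x)) \<le> Re (B x x)"
begin

lemma pow_add: "(T ^^ n) (x + y) = (T ^^ n) x + (T ^^ n) y"
  by (induction n) (auto simp: T_add)

lemma pow_sc: "(T ^^ n) (sc c x) = sc c ((T ^^ n) x)"
  by (induction n) (auto simp: T_sc)

lemma T_zero [simp]: "T 0 = 0"
  using T_add[of 0 0] by simp

lemma pow_zero [simp]: "(T ^^ n) 0 = 0"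
  by (induction n) auto

lemma T_sum: "T (\<Sum>i\<in>A. f i) = (\<Sum>i\<in>A. T (f i))"
  by (induction A rule: infinite_finite_induct) (auto simp: T_add)

lemma pow_sum: "(T ^^ n) (\<Sum>i\<in>A. f i) = (\<Sum>i\<in>A. (T ^^ n) (f i))"
  by (induction A rule: infinite_finite_induct) (auto simp: pow_add)

text \<open>
  The entries \<open>B(T\<^sup>b\<^sup>-\<^sup>a x, y)\<close> of a Toeplitz matrix, where negative powers of \<open>T\<close> are read as powers of the
  adjoint.
\<close>

definition toeplitz_entry :: "nat \<Rightarrow> nat \<Rightarrow> 'v \<Rightarrow> 'v \<Rightarrow> complex"
  where "toeplitz_entry a b x y = (if a \<le> b then B ((T ^^ (b - a)) x) y else B x ((T ^^ (a - b)) y))"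

lemma toeplitz_entry_commute: "toeplitz_entry a b x y = cnj (toeplitz_entry b a y x)"
  by (auto simp: toeplitz_entry_def commute[symmetric])

text \<open>
  The analogue for a contraction of the fact that \<open>\<Sum> B(U\<^sup>b\<^sup>-\<^sup>a f\<^sub>a, f\<^sub>b)\<close> is the square of a
  norm when \<open>U\<close> is unitary. With \<open>G\<^sub>n\<^sub>+\<^sub>1 = f\<^sub>n + T G\<^sub>n\<close>, passing from \<open>n\<close> to \<open>n + 1\<close> increases
  the sum by \<open>B(G\<^sub>n\<^sub>+\<^sub>1, G\<^sub>n\<^sub>+\<^sub>1) - B(T G\<^sub>n, T G\<^sub>n)\<close>, so the sum is at least \<open>B(G\<^sub>n, G\<^sub>n)\<close> throughout.
\<close>

lemma toeplitz_nonneg: "0 \<le> Re (\<Sum>a<n. \<Sum>b<n. toeplitz_entry a b (f a) (f b))"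
proof -
  define G where "G n = (\<Sum>a<n. (T ^^ (n - Suc a)) (f a))" for n
  define Q where "Q n = (\<Sum>a<n. \<Sum>b<n. toeplitz_entry a b (f a) (f b))" for n
  have G_Suc: "G (Suc n) = f n + T (G n)" for n
  proof -
    have "T (G n) = (\<Sum>a<n. T ((T ^^ (n - Suc a)) (f a)))"
      by (simp add: G_def T_sum)
    also have "\<dots> = (\<Sum>a<n. (T ^^ (n - a)) (f a))"
      by (intro sum.cong refl) (metis Suc_diff_Suc lessThan_iff funpow.simps(2) o_apply)
    finally show ?thesis
      by (simp add: G_def add.commute)
  qed
  have cross: "(\<Sum>a<n. toeplitz_entry a n (f a) (f n)) = B (T (G n)) (f n)" for n
  proof -
    have "T (G n) = (\<Sum>a<n. (T ^^ (n - a)) (f a))"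
      unfolding G_def T_sum
      by (intro sum.cong refl) (metis Suc_diff_Suc lessThan_iff funpow.simps(2) o_apply)
    then show ?thesis
      by (auto simp: sum_left toeplitz_entry_def intro!: sum.cong)
  qed
  have cross': "(\<Sum>b<n. toeplitz_entry n b (f n) (f b)) = cnj (B (T (G n)) (f n))" for n
    unfolding cross[symmetric] cnj_sum by (intro sum.cong refl toeplitz_entry_commute)
  have Q_Suc: "Q (Suc n) = Q n + B (T (G n)) (f n) + cnj (B (T (G n)) (f n)) + B (f n) (f n)" for n
    by (simp add: Q_def sum.distrib cross cross') (simp add: toeplitz_entry_def)
  have "Re (B (G n) (G n)) \<le> Re (Q n)" for n
  proof (induction n)
    case 0
    then show ?case by (simp add: G_def Q_def)
  next
    case (Suc n)
    have "B (G (Suc n)) (G (Suc n)) = B (f n) (f n) + cnj (B (T (G n)) (f n)) + B (T (G n)) (f n) + B (T (G n)) (T (G n))"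
      unfolding G_Suc add_left add_right using commute[of "f n" "T (G n)"] by simp
    then show ?case
      using Suc contr[of "G n"] by (simp add: Q_Suc)
  qed
  then show ?thesis
    using nonneg order_trans unfolding Q_def by blast
qed

text \<open>
  Up to the factor \<open>1/N\<close> this is the Fejer mean of the operator-valued Poisson kernel of \<open>T\<close> at the point
  \<open>w\<close> of the circle.
\<close>

definition fejer_form :: "nat \<Rightarrow> complex \<Rightarrow> 'v \<Rightarrow> 'v \<Rightarrow> complex"
  where "fejer_form N w x y = (\<Sum>a<N. \<Sum>b<N. w ^ a * cnj w ^ b * toeplitz_entry a b x y)"

lemma toeplitz_entry_add: "toeplitz_entry a b (x + y) z = toeplitz_entry a b x z + toeplitz_entry a b y z"
  by (simp add: toeplitz_entry_def add_left pow_add)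

lemma toeplitz_entry_sc: "toeplitz_entry a b (sc c x) y = c * toeplitz_entry a b x y"
  by (simp add: toeplitz_entry_def sc_left pow_sc)

lemma toeplitz_entry_sc_right: "toeplitz_entry a b x (sc c y) = cnj c * toeplitz_entry a b x y"
  by (simp add: toeplitz_entry_def sc_right pow_sc)

lemma fejer_form_semi_inner: "semi_inner (fejer_form N w) sc"
proof
  fix x y z c
  show "fejer_form N w (x + y) z = fejer_form N w x z + fejer_form N w y z"
    by (simp add: fejer_form_def toeplitz_entry_add distrib_left sum.distrib)
  show "fejer_form N w (sc c x) y = c * fejer_form N w x y"
    by (simp add: fejer_form_def toeplitz_entry_sc sum_distrib_left mult_ac)
  show "fejer_form N w x y = cnj (fejer_form N w y x)"
  proof -
    have "cnj (fejer_form N w y x) = (\<Sum>a<N. \<Sum>b<N. w ^ b * cnj w ^ a * cnj (toeplitz_entry a b y x))"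
      by (simp add: fejer_form_def cnj_sum mult.commute)
    also have "\<dots> = (\<Sum>a<N. \<Sum>b<N. w ^ b * cnj w ^ a * toeplitz_entry b a x y)"
      by (simp only: toeplitz_entry_commute[symmetric])
    also have "\<dots> = fejer_form N w x y"
      unfolding fejer_form_def by (rule sum.swap)
    finally show ?thesis ..
  qed
  have "fejer_form N w x x = (\<Sum>a<N. \<Sum>b<N. toeplitz_entry a b (sc (w ^ a) x) (sc (w ^ b) x))"
    by (simp add: fejer_form_def toeplitz_entry_sc toeplitz_entry_sc_right mult_ac)
  then show "0 \<le> Re (fejer_form N w x x)"
    using toeplitz_nonneg[of "\<lambda>a. sc (w ^ a) x" N] by simp
qed

text \<open>
  Von Neumann's inequality. The moments of the nonnegative kernel \<open>w \<mapsto> fejer_form N w\<close> are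
  \<open>(N - j) B(T\<^sup>j x, y)\<close>, so a polynomial in \<open>T\<close> is an average of the values of the polynomial on the
  circle against that kernel. Averages over sufficiently many roots of unity compute the moments exactly.
\<close>

lemma von_neumann_inequality:
  fixes c :: "nat \<Rightarrow> complex"
  assumes C: "\<And>w. cmod w = 1 \<Longrightarrow> cmod (\<Sum>j\<le>J. c j * w ^ j) \<le> C"
  shows "2 * cmod (\<Sum>j\<le>J. c j * B ((T ^^ j) x) y) \<le> C * (Re (B x x) + Re (B y y))"
proof -
  define \<omega> where "\<omega> M t = cis (2 * pi * real t / real M)" for M t :: nat
  have avg: "(\<Sum>t<M. \<omega> M t ^ j * fejer_form N (\<omega> M t) x y) = of_nat M * (of_nat (N - j) * B ((T ^^ j) x) y)"
    if "M \<ge> N + j" "M > 0" for N M j x y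
  proof -
    have "(\<Sum>t<M. \<omega> M t ^ j * fejer_form N (\<omega> M t) x y)
      = (\<Sum>t<M. \<Sum>a<N. \<Sum>b<N. \<omega> M t ^ j * \<omega> M t ^ a * cnj (\<omega> M t) ^ b * toeplitz_entry a b x y)"
      by (simp add: fejer_form_def sum_distrib_left mult.assoc)
    also have "\<dots> = (\<Sum>a<N. \<Sum>t<M. \<Sum>b<N. \<omega> M t ^ j * \<omega> M t ^ a * cnj (\<omega> M t) ^ b * toeplitz_entry a b x y)"
      by (rule sum.swap)
    also have "\<dots> = (\<Sum>a<N. \<Sum>b<N. \<Sum>t<M. \<omega> M t ^ j * \<omega> M t ^ a * cnj (\<omega> M t) ^ b * toeplitz_entry a b x y)"
      by (rule sum.cong[OF refl], rule sum.swap)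
    also have "\<dots> = (\<Sum>a<N. \<Sum>b<N. (\<Sum>t<M. \<omega> M t ^ j * \<omega> M t ^ a * cnj (\<omega> M t) ^ b) * toeplitz_entry a b x y)"
      by (simp only: sum_distrib_right)
    also have "\<dots> = (\<Sum>a<N. \<Sum>b<N. (if b = a + j then of_nat M else 0) * toeplitz_entry a b x y)"
    proof (intro sum.cong refl)
      fix a b assume "a \<in> {..<N}" "b \<in> {..<N}"
      then have "(\<Sum>t<M. \<omega> M t ^ (j + a) * cnj (\<omega> M t) ^ b) = (if j + a = b then of_nat M else 0)"
        unfolding \<omega>_def using that by (intro sum_roots_of_unity_diff) auto
      note H = this
      show "(\<Sum>t<M. \<omega> M t ^ j * \<omega> M t ^ a * cnj (\<omega> M t) ^ b) * toeplitz_entry a b x y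
        = (if b = a + j then of_nat M else 0) * toeplitz_entry a b x y"
        using H by (simp add: power_add eq_commute[of b] add.commute[of a j])
    qed
    also have "\<dots> = (\<Sum>a<N. if a + j < N then of_nat M * B ((T ^^ j) x) y else 0)"
    proof (intro sum.cong refl)
      fix a
      have "(\<Sum>b<N. (if b = a + j then of_nat M else 0) * toeplitz_entry a b x y)
          = (\<Sum>b<N. if b = a + j then of_nat M * toeplitz_entry a b x y else 0)"
        by (intro sum.cong) auto
      then show "(\<Sum>b<N. (if b = a + j then of_nat M else 0) * toeplitz_entry a b x y)
          = (if a + j < N then of_nat M * B ((T ^^ j) x) y else 0)"
        by (simp add: toeplitz_entry_def)
    qed
    also have "\<dots> = of_nat M * (of_nat (N - j) * B ((T ^^ j) x) y)"
    proof -
      have "{..<N} \<inter> {a. a + j < N} = {..<N - j}" by auto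
      then show ?thesis
        by (simp add: sum.If_cases)
    qed
    finally show ?thesis .
  qed
  show ?thesis
  proof (rule fejer_limit[where \<kappa> = "\<lambda>j. j"])
    fix N :: nat assume N: "N > 0"
    (* The exponents j + a - b have modulus less than N + J. *)
    define M where "M = N + J"
    have "M > 0" using N by (simp add: M_def)
    have avg0: "(\<Sum>t<M. fejer_form N (\<omega> M t) x x) = of_nat M * (of_nat N * B x x)" for x
    proof -
      have "M \<ge> N + 0" by (simp add: M_def)
      from avg[OF this \<open>M > 0\<close>, of x x] show ?thesis by simp
    qed
    have "of_nat M * (of_nat (N - j) * (c j * B ((T ^^ j) x) y))
        = c j * (\<Sum>t<M. \<omega> M t ^ j * fejer_form N (\<omega> M t) x y)" if "j \<le> J" for j
    proof -
      have "M \<ge> N + j" using that by (simp add: M_def)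
      from avg[OF this \<open>M > 0\<close>, of x y] show ?thesis by (simp only: mult.left_commute)
    qed
    then have "of_nat M * (\<Sum>j\<le>J. of_nat (N - j) * (c j * B ((T ^^ j) x) y))
        = (\<Sum>j\<le>J. c j * (\<Sum>t<M. \<omega> M t ^ j * fejer_form N (\<omega> M t) x y))"
      unfolding sum_distrib_left[of "of_nat M"] by (intro sum.cong) auto
    also have "\<dots> = (\<Sum>j\<le>J. \<Sum>t<M. c j * \<omega> M t ^ j * fejer_form N (\<omega> M t) x y)"
      by (simp only: sum_distrib_left mult.assoc)
    also have "\<dots> = (\<Sum>t<M. \<Sum>j\<le>J. c j * \<omega> M t ^ j * fejer_form N (\<omega> M t) x y)"
      by (rule sum.swap)
    also have "\<dots> = (\<Sum>t<M. (\<Sum>j\<le>J. c j * \<omega> M t ^ j) * fejer_form N (\<omega> M t) x y)"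
      by (simp only: sum_distrib_right)
    finally have eq: "of_nat M * (\<Sum>j\<le>J. of_nat (N - j) * (c j * B ((T ^^ j) x) y))
        = (\<Sum>t<M. (\<Sum>j\<le>J. c j * \<omega> M t ^ j) * fejer_form N (\<omega> M t) x y)" .
    have "M * (2 * cmod (\<Sum>j\<le>J. of_nat (N - j) * (c j * B ((T ^^ j) x) y)))
        = 2 * cmod (of_nat M * (\<Sum>j\<le>J. of_nat (N - j) * (c j * B ((T ^^ j) x) y)))"
      by (simp add: norm_mult)
    also have "\<dots> = 2 * cmod (\<Sum>t<M. (\<Sum>j\<le>J. c j * \<omega> M t ^ j) * fejer_form N (\<omega> M t) x y)"
      by (simp only: eq)
    also have "\<dots> \<le> 2 * (\<Sum>t<M. cmod (\<Sum>j\<le>J. c j * \<omega> M t ^ j) * cmod (fejer_form N (\<omega> M t) x y))"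
      by (intro mult_left_mono order_trans[OF norm_sum]) (auto simp: norm_mult)
    also have "\<dots> \<le> (\<Sum>t<M. C * (Re (fejer_form N (\<omega> M t) x x) + Re (fejer_form N (\<omega> M t) y y)))"
      unfolding sum_distrib_left
    proof (intro sum_mono)
      fix t
      have 1: "cmod (\<Sum>j\<le>J. c j * \<omega> M t ^ j) \<le> C"
        by (intro C) (simp add: \<omega>_def)
      have 2: "2 * cmod (fejer_form N (\<omega> M t) x y) \<le> Re (fejer_form N (\<omega> M t) x x) + Re (fejer_form N (\<omega> M t) y y)"
        by (rule semi_inner.norm_le[OF fejer_form_semi_inner])
      have "cmod (\<Sum>j\<le>J. c j * \<omega> M t ^ j) * (2 * cmod (fejer_form N (\<omega> M t) x y))
         \<le> C * (Re (fejer_form N (\<omega> M t) x x) + Re (fejer_form N (\<omega> M t) y y))"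
        using 1 order_trans[OF norm_ge_zero 1] by (intro mult_mono 2) auto
      then show "2 * (cmod (\<Sum>j\<le>J. c j * \<omega> M t ^ j) * cmod (fejer_form N (\<omega> M t) x y))
         \<le> C * (Re (fejer_form N (\<omega> M t) x x) + Re (fejer_form N (\<omega> M t) y y))"
        by (simp add: mult_ac)
    qed
    also have "\<dots> = C * (Re (\<Sum>t<M. fejer_form N (\<omega> M t) x x) + Re (\<Sum>t<M. fejer_form N (\<omega> M t) y y))"
      by (simp add: sum.distrib flip: sum_distrib_left)
    also have "\<dots> = C * (M * N * (Re (B x x) + Re (B y y)))"
      by (simp add: avg0 distrib_left mult.assoc)
    finally have "M * (2 * cmod (\<Sum>j\<le>J. of_nat (N - j) * (c j * B ((T ^^ j) x) y)))
        \<le> M * (N * (C * (Re (B x x) + Re (B y y))))"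
      by (simp only: mult_ac of_nat_mult)
    then show "2 * cmod (\<Sum>j\<le>J. of_nat (N - j) * (c j * B ((T ^^ j) x) y)) \<le> N * (C * (Re (B x x) + Re (B y y)))"
      using \<open>M > 0\<close> by simp
  qed
qed

end

section \<open>The inequality of Ando for two commuting contractions\<close>

lemma clinear_op_pow: "clinear_op S \<Longrightarrow> (blinfun_apply S ^^ n) (c *c x) = c *c (blinfun_apply S ^^ n) x"
  by (induction n) (auto simp: clinear_op_def)

text \<open>
  The strict bound on \<open>R = S\<^sub>1 S\<^sub>2\<close> makes the form \<open>\<langle>x, y\<rangle> - \<langle>R x, R y\<rangle>\<close> coercive, so that the
  projection defined below exists.
\<close>

locale commuting_contractions =
  fixes S1 S2 :: "'a :: complex_hilbert_space \<Rightarrow>\<^sub>L 'a"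
  assumes lin1: "clinear_op S1" and lin2: "clinear_op S2"
    and comm: "S1 o\<^sub>L S2 = S2 o\<^sub>L S1"
    and norm1: "norm S1 \<le> 1" and norm2: "norm S2 \<le> 1"
    and norm12: "norm (S1 o\<^sub>L S2) < 1"
begin

abbreviation "R \<equiv> S1 o\<^sub>L S2"

lemma S1_le: "norm (S1 x) \<le> norm x"
  using norm_blinfun[of S1 x] norm1 mult_right_mono[OF norm1 norm_ge_zero[of x]] by simp

lemma S2_le: "norm (S2 x) \<le> norm x"
  using norm_blinfun[of S2 x] norm2 mult_right_mono[OF norm2 norm_ge_zero[of x]] by simp

lemma S1_S2: "S1 (S2 x) = S2 (S1 x)"
  by (metis comm blinfun_apply_blinfun_compose)

lemma S1_sc: "S1 (c *c x) = c *c S1 x" and S2_sc: "S2 (c *c x) = c *c S2 x"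
  using lin1 lin2 by (auto simp: clinear_op_def)

lemma pow_S1_S2: "(blinfun_apply S1 ^^ n) (S2 x) = S2 ((blinfun_apply S1 ^^ n) x)"
  by (induction n) (auto simp: S1_S2)

definition defect_form :: "'a \<Rightarrow> 'a \<Rightarrow> real"
  where "defect_form x y = inner x y - inner (R x) (R y)"

lemma bounded_bilinear_defect_form: "bounded_bilinear defect_form"
proof (rule bounded_bilinear.intro)
  show "\<exists>K. \<forall>x y. norm (defect_form x y) \<le> norm x * norm y * K"
  proof (intro exI allI)
    fix x y
    have "norm (defect_form x y) \<le> norm (inner x y) + norm (inner (R x) (R y))"
      unfolding defect_form_def by (rule norm_triangle_ineq4)
    also have "\<dots> \<le> norm x * norm y + norm (R x) * norm (R y)"
      unfolding real_norm_def by (intro add_mono Cauchy_Schwarz_ineq2)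
    also have "norm (R x) * norm (R y) \<le> (norm R * norm x) * (norm R * norm y)"
      by (intro mult_mono norm_blinfun) auto
    finally show "norm (defect_form x y) \<le> norm x * norm y * (1 + norm R * norm R)"
      by (simp add: algebra_simps)
  qed
qed (simp_all add: defect_form_def blinfun.add_right blinfun.scaleR_right inner_add_left inner_add_right algebra_simps)

text \<open>
  The semi-inner product of \<open>(x, y)\<close> with \<open>(k, S\<^sub>1 k)\<close> in \<open>q\<^sub>1 \<oplus> q\<^sub>2\<close>, where
  \<open>q\<^sub>i(x) = \<parallel>x\<parallel>\<^sup>2 - \<parallel>S\<^sub>i x\<parallel>\<^sup>2\<close>. On the graph of \<open>S\<^sub>1\<close> this form is the defect form of
  \<open>R\<close>, because \<open>q\<^sub>1(k) + q\<^sub>2(S\<^sub>1 k) = \<parallel>k\<parallel>\<^sup>2 - \<parallel>R k\<parallel>\<^sup>2\<close>.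
\<close>

definition link_functional :: "'a \<Rightarrow> 'a \<Rightarrow> 'a \<Rightarrow> real"
  where "link_functional x y k = inner x k - inner (S1 x) (S1 k) + inner y (S1 k) - inner (S2 y) (S2 (S1 k))"

lemma bounded_linear_link_functional: "bounded_linear (link_functional x y)"
  unfolding link_functional_def
  by (intro bounded_linear_sub bounded_linear_add
      bounded_linear_compose[OF bounded_linear_inner_right] blinfun.bounded_linear_right
      bounded_linear_inner_right bounded_linear_compose[OF blinfun.bounded_linear_right, of S1 S2])

lemma link_ex1: "\<exists>!l. \<forall>k. defect_form l k = link_functional x y k"
proof (rule coercive_form_represents[OF bounded_bilinear_defect_form _ _ _ bounded_linear_link_functional])
  show "1 - (norm R)\<^sup>2 > 0"
    using norm12 by (simp add: power_less_one_iff abs_square_less_1)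
  fix x y
  show "defect_form x y = defect_form y x"
    by (simp add: defect_form_def inner_commute)
  have "(norm (R x))\<^sup>2 \<le> (norm R * norm x)\<^sup>2"
    by (intro power_mono norm_blinfun) simp
  then show "(1 - (norm R)\<^sup>2) * (norm x)\<^sup>2 \<le> defect_form x x"
    unfolding defect_form_def power2_norm_eq_inner[symmetric] by (simp add: algebra_simps power_mult_distrib)
qed

text \<open>
  The first component of the orthogonal projection of \<open>(x, y)\<close> onto the graph of \<open>S\<^sub>1\<close> with respect
  to \<open>q\<^sub>1 \<oplus> q\<^sub>2\<close>. The map \<open>(x, y) \<mapsto> (S\<^sub>2 l, l)\<close> with \<open>l = link x y\<close> extends the isometry
  \<open>(x, S\<^sub>1 x) \<mapsto> (S\<^sub>2 x, x)\<close>, which is the core of Ando's dilation.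
\<close>

definition link :: "'a \<Rightarrow> 'a \<Rightarrow> 'a"
  where "link x y = (THE l. \<forall>k. defect_form l k = link_functional x y k)"

lemma defect_form_link: "defect_form (link x y) k = link_functional x y k"
  using theI'[OF link_ex1[of x y]] by (simp add: link_def)

lemma link_unique: "(\<And>k. defect_form l k = link_functional x y k) \<Longrightarrow> link x y = l"
  using link_ex1[of x y] defect_form_link[of x y] by blast

lemma link_graph: "link x (S1 x) = x"
  by (rule link_unique) (simp add: defect_form_def link_functional_def S1_S2)

lemma link_add: "link (x + x') (y + y') = link x y + link x' y'"
proof (rule link_unique)
  fix k
  have "defect_form (link x y + link x' y') k = defect_form (link x y) k + defect_form (link x' y') k"
    by (simp add: defect_form_def blinfun.add_right inner_add_left)
  then show "defect_form (link x y + link x' y') k = link_functional (x + x') (y + y') k"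
    by (simp add: defect_form_link link_functional_def blinfun.add_right inner_add_left)
qed

lemma link_sc: "link (c *c x) (c *c y) = c *c link x y"
proof (rule link_unique)
  fix k
  have "defect_form (c *c link x y) k = defect_form (link x y) (cnj c *c k)"
    by (simp add: defect_form_def S1_sc S2_sc inner_scaleC)
  then show "defect_form (c *c link x y) k = link_functional (c *c x) (c *c y) k"
    by (simp add: defect_form_link link_functional_def S1_sc S2_sc inner_scaleC)
qed

text \<open>
  \<open>q\<^sub>1(S\<^sub>2 l) + q\<^sub>2(l) = \<parallel>l\<parallel>\<^sup>2 - \<parallel>R l\<parallel>\<^sup>2\<close> is the squared length of the projection \<open>(l, S\<^sub>1 l)\<close> of
  \<open>(x, y)\<close>, and a projection does not increase lengths.
\<close>

lemma link_contraction:
  "(norm (S2 (link x y)))\<^sup>2 - (norm (S1 (S2 (link x y))))\<^sup>2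
     + (norm (link x y))\<^sup>2 - (norm (S2 (link x y)))\<^sup>2
   \<le> (norm x)\<^sup>2 - (norm (S1 x))\<^sup>2 + (norm y)\<^sup>2 - (norm (S2 y))\<^sup>2"
proof -
  define l where "l = link x y"
  have l: "(norm l)\<^sup>2 - (norm (S1 (S2 l)))\<^sup>2 = link_functional x y l"
    using defect_form_link[of x y l] by (simp add: l_def defect_form_def power2_norm_eq_inner)
  have 1: "(norm (S1 (x - l)))\<^sup>2 \<le> (norm (x - l))\<^sup>2"
    by (intro power_mono S1_le) simp
  have 2: "(norm (S2 (y - S1 l)))\<^sup>2 \<le> (norm (y - S1 l))\<^sup>2"
    by (intro power_mono S2_le) simp
  have "0 \<le> (norm (x - l))\<^sup>2 - (norm (S1 (x - l)))\<^sup>2 + (norm (y - S1 l))\<^sup>2 - (norm (S2 (y - S1 l)))\<^sup>2"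
    using 1 2 by linarith
  also have "\<dots> = (norm x)\<^sup>2 - (norm (S1 x))\<^sup>2 + (norm y)\<^sup>2 - (norm (S2 y))\<^sup>2
      + ((norm l)\<^sup>2 - (norm (S1 (S2 l)))\<^sup>2) - 2 * link_functional x y l"
    unfolding power2_norm_eq_inner link_functional_def
    by (simp add: blinfun.diff_right inner_diff_left inner_diff_right inner_commute S1_S2)
  finally show ?thesis
    using l unfolding l_def by linarith
qed

text \<open>
  The states of a linear system with input \<open>x\<close>. The entry \<open>x 0\<close> is the initial state, measured in
  the norm of the Hilbert space; the later entries are inputs, measured by \<open>q\<^sub>1\<close>.
\<close>

primrec state :: "(nat \<Rightarrow> 'a) \<Rightarrow> nat \<Rightarrow> 'a"
  where "state x 0 = x 0" | "state x (Suc n) = link (x (Suc n)) (state x n)"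

text \<open>
  The output of the system. It lifts \<open>S\<^sub>2\<close>: on a sequence that consists of iterates of \<open>S\<^sub>1\<close> the
  state follows these iterates.
\<close>

definition lift :: "(nat \<Rightarrow> 'a) \<Rightarrow> nat \<Rightarrow> 'a"
  where "lift x n = S2 (state x n)"

definition model_form :: "nat \<Rightarrow> (nat \<Rightarrow> 'a) \<Rightarrow> (nat \<Rightarrow> 'a) \<Rightarrow> complex"
  where "model_form V x y = cinner (x 0) (y 0)
    + (\<Sum>n<V. cinner (x (Suc n)) (y (Suc n)) - cinner (S1 (x (Suc n))) (S1 (y (Suc n))))"

definition scale_seq :: "complex \<Rightarrow> (nat \<Rightarrow> 'a) \<Rightarrow> nat \<Rightarrow> 'a"
  where "scale_seq c x = (\<lambda>n. c *c x n)"

lemma state_add: "state (x + y) n = state x n + state y n"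
  by (induction n) (auto simp: link_add)

lemma state_sc: "state (scale_seq c x) n = c *c state x n"
  by (induction n) (auto simp: link_sc scale_seq_def)

text \<open>
  The system dissipates energy. Each step transforms \<open>q\<^sub>1(input) + q\<^sub>2(old state)\<close> into at least
  \<open>q\<^sub>1(output) + q\<^sub>2(new state)\<close>, so the terms \<open>q\<^sub>2\<close> telescope and leave a nonnegative remainder.
\<close>

lemma lift_semi_contraction: "semi_contraction (model_form V) scale_seq lift"
proof
  fix x y z :: "nat \<Rightarrow> 'a" and c
  show "model_form V (x + y) z = model_form V x z + model_form V y z"
    by (simp add: model_form_def blinfun.add_right cinner_add_left sum.distrib sum_subtractf)
  show "model_form V (scale_seq c x) y = c * model_form V x y"
    by (simp add: model_form_def scale_seq_def S1_sc cinner_scaleC_left sum_distrib_left algebra_simps)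
  show "model_form V x y = cnj (model_form V y x)"
    unfolding model_form_def complex_cnj_add cnj_sum complex_cnj_diff cinner_commute[symmetric] ..
  have self: "Re (model_form V x x) = (norm (x 0))\<^sup>2 + (\<Sum>n<V. (norm (x (Suc n)))\<^sup>2 - (norm (S1 (x (Suc n))))\<^sup>2)" for x
    by (simp add: model_form_def Re_cinner_self)
  show "0 \<le> Re (model_form V x x)"
    unfolding self by (intro add_nonneg_nonneg sum_nonneg) (auto intro!: power_mono S1_le)
  show "lift (x + y) = lift x + lift y"
    by (rule ext) (simp add: lift_def state_add blinfun.add_right)
  show "lift (scale_seq c x) = scale_seq c (lift x)"
    by (rule ext) (simp add: lift_def scale_seq_def state_sc[unfolded scale_seq_def] S2_sc)
  have "Re (model_form V (lift x) (lift x)) + (norm (state x V))\<^sup>2 - (norm (S2 (state x V)))\<^sup>2 \<le> Re (model_form V x x)"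
  proof (induction V)
    case 0
    then show ?case by (simp add: model_form_def Re_cinner_self lift_def)
  next
    case (Suc V)
    then show ?case
      using link_contraction[of "x (Suc V)" "state x V"]
      by (simp add: model_form_def Re_cinner_self lift_def)
  qed
  moreover have "(norm (S2 (state x V)))\<^sup>2 \<le> (norm (state x V))\<^sup>2"
    by (intro power_mono S2_le) simp
  ultimately show "Re (model_form V (lift x) (lift x)) \<le> Re (model_form V x x)"
    by linarith
qed

text \<open>
  A copy of \<open>h\<close> in the sequence space, isometric for the model forms of length at least \<open>b\<close>. Increasing \<open>b\<close> by one shifts the
  copy by one place, which on the original space corresponds to one application of \<open>S\<^sub>1\<close>. The entries beyond
  \<open>b\<close> must vanish so that copies with different \<open>b\<close> pair correctly.
\<close>

definition orbit :: "nat \<Rightarrow> 'a \<Rightarrow> nat \<Rightarrow> 'a"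
  where "orbit b h m = (if m \<le> b then (blinfun_apply S1 ^^ (b - m)) h else 0)"

lemma state_orbit:
  assumes "\<And>m. m \<le> b \<Longrightarrow> x m = (blinfun_apply S1 ^^ (b - m)) h" "m \<le> b"
  shows "state x m = (blinfun_apply S1 ^^ (b - m)) h"
  using assms(2)
proof (induction m)
  case (Suc m)
  then have "(blinfun_apply S1 ^^ (b - m)) h = S1 ((blinfun_apply S1 ^^ (b - Suc m)) h)"
    by (metis Suc_diff_Suc Suc_le_lessD funpow.simps(2) o_apply)
  then show ?case
    using Suc assms(1)[of "Suc m"] by (simp add: link_graph)
qed (simp add: assms(1))

lemma lift_pow_orbit: "m \<le> b \<Longrightarrow> (lift ^^ j) (orbit b h) m = (blinfun_apply S1 ^^ (b - m)) ((blinfun_apply S2 ^^ j) h)"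
proof (induction j arbitrary: m)
  case 0
  then show ?case by (simp add: orbit_def)
next
  case (Suc j)
  have "state ((lift ^^ j) (orbit b h)) m = (blinfun_apply S1 ^^ (b - m)) ((blinfun_apply S2 ^^ j) h)"
    by (rule state_orbit[where b = b]) (use Suc in auto)
  moreover have "(lift ^^ Suc j) (orbit b h) m = S2 (state ((lift ^^ j) (orbit b h)) m)"
    by (simp only: funpow.simps o_apply lift_def[of "(lift ^^ j) (orbit b h)" m])
  ultimately show ?case
    by (simp add: pow_S1_S2)
qed

text \<open>
  The entries up to \<open>b'\<close> are the only ones that contribute, and there the lifted sequence is known
  exactly. Their contributions \<open>q\<^sub>1(S\<^sub>1\<^sup>m \<dots>)\<close> telescope.
\<close>

lemma model_form_orbit:
  assumes "b' \<le> b" "b' \<le> V"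
  shows "model_form V ((lift ^^ j) (orbit b h)) (orbit b' k) = cinner ((blinfun_apply S1 ^^ (b - b')) ((blinfun_apply S2 ^^ j) h)) k"
proof -
  define g where "g = (blinfun_apply S2 ^^ j) h"
  define s where "s n = cinner ((blinfun_apply S1 ^^ (b - n)) g) ((blinfun_apply S1 ^^ (b' - n)) k)" for n
  define F where "F n = cinner ((lift ^^ j) (orbit b h) (Suc n)) (orbit b' k (Suc n))
    - cinner (S1 ((lift ^^ j) (orbit b h) (Suc n))) (S1 (orbit b' k (Suc n)))" for n
  have F1: "F n = s (Suc n) - s n" if "n < b'" for n
  proof -
    have "(blinfun_apply S1 ^^ (b - n)) g = S1 ((blinfun_apply S1 ^^ (b - Suc n)) g)" "(blinfun_apply S1 ^^ (b' - n)) k = S1 ((blinfun_apply S1 ^^ (b' - Suc n)) k)"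
      using that assms by (metis Suc_diff_Suc order_less_le_trans funpow.simps(2) o_apply)+
    then show ?thesis
      using that assms by (simp add: F_def s_def lift_pow_orbit g_def) (simp add: orbit_def)
  qed
  have F2: "F n = 0" if "n \<ge> b'" for n
    using that by (simp add: F_def orbit_def)
  have "model_form V ((lift ^^ j) (orbit b h)) (orbit b' k) = s 0 + (\<Sum>n<V. F n)"
    using assms by (simp add: model_form_def F_def s_def lift_pow_orbit g_def) (simp add: orbit_def)
  also have "(\<Sum>n<V. F n) = (\<Sum>n<b'. F n)"
    by (rule sum.mono_neutral_right) (use assms F2 in auto)
  also have "\<dots> = (\<Sum>n<b'. s (Suc n) - s n)"
    by (intro sum.cong) (auto simp: F1)
  also have "\<dots> = s b' - s 0"
    by (rule sum_lessThan_telescope)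
  finally show ?thesis
    by (simp add: s_def g_def)
qed

text \<open>
  For a point \<open>u\<close> of the circle, \<open>X(u) = \<Sum> u\<^sup>b (orbit b h)\<close> behaves like an eigenvector of the shift, up
  to boundary terms that the Fejer weights account for. Von Neumann's inequality for the lift, applied
  to the polynomial that results from fixing the first variable at the conjugate of \<open>u\<close>, and averaged over roots of
  unity \<open>u\<close>, gives the inequality in two variables.
\<close>

theorem ando_inequality_strict:
  fixes c :: "nat \<Rightarrow> nat \<Rightarrow> complex"
  assumes C: "\<And>z w. cmod z = 1 \<Longrightarrow> cmod w = 1 \<Longrightarrow> cmod (\<Sum>i\<le>I. \<Sum>j\<le>J. c i j * z ^ i * w ^ j) \<le> C"
  shows "2 * cmod (\<Sum>i\<le>I. \<Sum>j\<le>J. c i j * cinner ((blinfun_apply S1 ^^ i) ((blinfun_apply S2 ^^ j) h)) k) \<le> C * ((norm h)\<^sup>2 + (norm k)\<^sup>2)"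
proof -
  define d where "d i = (\<Sum>j\<le>J. c i j * cinner ((blinfun_apply S1 ^^ i) ((blinfun_apply S2 ^^ j) h)) k)" for i
  have "2 * cmod (\<Sum>i\<le>I. d i) \<le> C * ((norm h)\<^sup>2 + (norm k)\<^sup>2)"
  proof (rule fejer_limit[where \<kappa> = "\<lambda>i. i"])
    fix N :: nat assume N: "N > 0"
    (* The model form reaches up to the index N - 1 of the last of the N orbits. *)
    define V where "V = N - 1"
    have V: "b \<le> V \<longleftrightarrow> b < N" for b
      using N by (auto simp: V_def)
    interpret f: semi_contraction "model_form V" scale_seq lift
      by (rule lift_semi_contraction)
    (* The exponents b - b' - i that occur have modulus less than N + I, so sums over (N + I)-th
       roots of unity detect exactly those that vanish. *)
    define M where "M = N + I"
    have M: "M > 0" using N by (simp add: M_def)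
    define \<omega> where "\<omega> t = cis (2 * pi * real t / real M)" for t :: nat
    have \<omega>1: "cmod (\<omega> t) = 1" for t
      by (simp add: \<omega>_def)
    define X where "X u h = (\<Sum>b<N. scale_seq (u ^ b) (orbit b h))" for u h
    define c' where "c' u j = (\<Sum>i\<le>I. c i j * cnj u ^ i)" for u j
    have step: "2 * cmod (\<Sum>j\<le>J. c' u j * model_form V ((lift ^^ j) (X u h)) (X u k))
        \<le> C * (Re (model_form V (X u h) (X u h)) + Re (model_form V (X u k) (X u k)))" if "cmod u = 1" for u
    proof (rule f.von_neumann_inequality)
      fix w assume "cmod w = 1"
      have "(\<Sum>j\<le>J. c' u j * w ^ j) = (\<Sum>j\<le>J. \<Sum>i\<le>I. c i j * cnj u ^ i * w ^ j)"
        by (simp add: c'_def sum_distrib_right)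
      also have "\<dots> = (\<Sum>i\<le>I. \<Sum>j\<le>J. c i j * cnj u ^ i * w ^ j)"
        by (rule sum.swap)
      finally show "cmod (\<Sum>j\<le>J. c' u j * w ^ j) \<le> C"
        using C[of "cnj u" w] that \<open>cmod w = 1\<close> by simp
    qed
    have expand: "model_form V ((lift ^^ j) (X u h)) (X u k)
      = (\<Sum>b<N. \<Sum>b'<N. u ^ b * cnj u ^ b' * model_form V ((lift ^^ j) (orbit b h)) (orbit b' k))" for u j h k
    proof -
      have left: "model_form V ((lift ^^ j) (X u h)) Y = (\<Sum>b<N. u ^ b * model_form V ((lift ^^ j) (orbit b h)) Y)" for Y
        by (simp add: X_def f.pow_sum f.pow_sc f.sum_left f.sc_left)
      have right: "model_form V Y (X u k) = (\<Sum>b<N. cnj u ^ b * model_form V Y (orbit b k))" for Y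
        by (simp add: X_def f.sum_right f.sc_right)
      show ?thesis
        unfolding left by (simp only: right sum_distrib_left mult.assoc)
    qed
    have avg: "(\<Sum>t<M. cnj (\<omega> t) ^ i * model_form V ((lift ^^ j) (X (\<omega> t) h)) (X (\<omega> t) k))
      = of_nat M * (of_nat (N - i) * cinner ((blinfun_apply S1 ^^ i) ((blinfun_apply S2 ^^ j) h)) k)" if "i \<le> I" for i j h k
    proof -
      define \<beta> where "\<beta> b b' = model_form V ((lift ^^ j) (orbit b h)) (orbit b' k)" for b b'
      have "(\<Sum>t<M. cnj (\<omega> t) ^ i * model_form V ((lift ^^ j) (X (\<omega> t) h)) (X (\<omega> t) k))
        = (\<Sum>t<M. \<Sum>b<N. \<Sum>b'<N. \<omega> t ^ b * cnj (\<omega> t) ^ (b' + i) * \<beta> b b')"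
        by (simp add: expand \<beta>_def sum_distrib_left power_add mult_ac)
      also have "\<dots> = (\<Sum>b<N. \<Sum>t<M. \<Sum>b'<N. \<omega> t ^ b * cnj (\<omega> t) ^ (b' + i) * \<beta> b b')"
        by (rule sum.swap)
      also have "\<dots> = (\<Sum>b<N. \<Sum>b'<N. \<Sum>t<M. \<omega> t ^ b * cnj (\<omega> t) ^ (b' + i) * \<beta> b b')"
        by (rule sum.cong[OF refl], rule sum.swap)
      also have "\<dots> = (\<Sum>b'<N. \<Sum>b<N. \<Sum>t<M. \<omega> t ^ b * cnj (\<omega> t) ^ (b' + i) * \<beta> b b')"
        by (rule sum.swap)
      also have "\<dots> = (\<Sum>b'<N. \<Sum>b<N. if b = b' + i then of_nat M * \<beta> b b' else 0)"
      proof (rule sum.cong[OF refl], rule sum.cong[OF refl])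
        fix b b' assume "b' \<in> {..<N}" "b \<in> {..<N}"
        then have "(\<Sum>t<M. \<omega> t ^ b * cnj (\<omega> t) ^ (b' + i)) = (if b = b' + i then of_nat M else 0)"
          using that unfolding \<omega>_def by (intro sum_roots_of_unity_diff) (auto simp: M_def)
        then show "(\<Sum>t<M. \<omega> t ^ b * cnj (\<omega> t) ^ (b' + i) * \<beta> b b') = (if b = b' + i then of_nat M * \<beta> b b' else 0)"
          by (simp flip: sum_distrib_right)
      qed
      also have "\<dots> = (\<Sum>b'<N. if b' + i < N then of_nat M * cinner ((blinfun_apply S1 ^^ i) ((blinfun_apply S2 ^^ j) h)) k else 0)"
      proof (rule sum.cong[OF refl])
        fix b' assume "b' \<in> {..<N}"
        then have "\<beta> (b' + i) b' = cinner ((blinfun_apply S1 ^^ i) ((blinfun_apply S2 ^^ j) h)) k"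
          unfolding \<beta>_def by (subst model_form_orbit) (auto simp: V)
        then show "(\<Sum>b<N. if b = b' + i then of_nat M * \<beta> b b' else 0)
            = (if b' + i < N then of_nat M * cinner ((blinfun_apply S1 ^^ i) ((blinfun_apply S2 ^^ j) h)) k else 0)"
          by simp
      qed
      also have "\<dots> = of_nat M * (of_nat (N - i) * cinner ((blinfun_apply S1 ^^ i) ((blinfun_apply S2 ^^ j) h)) k)"
      proof -
        have "{..<N} \<inter> {a. a + i < N} = {..<N - i}" by auto
        then show ?thesis
          by (simp add: sum.If_cases)
      qed
      finally show ?thesis .
    qed
    have avg0: "(\<Sum>t<M. model_form V (X (\<omega> t) h) (X (\<omega> t) h)) = of_nat M * (of_nat N * complex_of_real ((norm h)\<^sup>2))" for h
      using avg[of 0 0 h h] by (simp add: cinner_self)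
    have "of_nat M * (\<Sum>i\<le>I. of_nat (N - i) * d i)
      = (\<Sum>i\<le>I. \<Sum>j\<le>J. c i j * (of_nat M * (of_nat (N - i) * cinner ((blinfun_apply S1 ^^ i) ((blinfun_apply S2 ^^ j) h)) k)))"
      by (simp add: d_def sum_distrib_left mult_ac)
    also have "\<dots> = (\<Sum>i\<le>I. \<Sum>j\<le>J. c i j * (\<Sum>t<M. cnj (\<omega> t) ^ i * model_form V ((lift ^^ j) (X (\<omega> t) h)) (X (\<omega> t) k)))"
      by (intro sum.cong refl) (simp add: avg)
    also have "\<dots> = (\<Sum>i\<le>I. \<Sum>j\<le>J. \<Sum>t<M. c i j * cnj (\<omega> t) ^ i * model_form V ((lift ^^ j) (X (\<omega> t) h)) (X (\<omega> t) k))"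
      by (simp only: sum_distrib_left mult.assoc)
    also have "\<dots> = (\<Sum>i\<le>I. \<Sum>t<M. \<Sum>j\<le>J. c i j * cnj (\<omega> t) ^ i * model_form V ((lift ^^ j) (X (\<omega> t) h)) (X (\<omega> t) k))"
      by (rule sum.cong[OF refl], rule sum.swap)
    also have "\<dots> = (\<Sum>t<M. \<Sum>i\<le>I. \<Sum>j\<le>J. c i j * cnj (\<omega> t) ^ i * model_form V ((lift ^^ j) (X (\<omega> t) h)) (X (\<omega> t) k))"
      by (rule sum.swap)
    also have "\<dots> = (\<Sum>t<M. \<Sum>j\<le>J. \<Sum>i\<le>I. c i j * cnj (\<omega> t) ^ i * model_form V ((lift ^^ j) (X (\<omega> t) h)) (X (\<omega> t) k))"
      by (rule sum.cong[OF refl], rule sum.swap)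
    also have "\<dots> = (\<Sum>t<M. \<Sum>j\<le>J. c' (\<omega> t) j * model_form V ((lift ^^ j) (X (\<omega> t) h)) (X (\<omega> t) k))"
      by (simp only: c'_def sum_distrib_right)
    finally have eq: "of_nat M * (\<Sum>i\<le>I. of_nat (N - i) * d i)
      = (\<Sum>t<M. \<Sum>j\<le>J. c' (\<omega> t) j * model_form V ((lift ^^ j) (X (\<omega> t) h)) (X (\<omega> t) k))" .
    have "M * (2 * cmod (\<Sum>i\<le>I. of_nat (N - i) * d i)) = 2 * cmod (of_nat M * (\<Sum>i\<le>I. of_nat (N - i) * d i))"
      by (simp add: norm_mult)
    also have "\<dots> \<le> 2 * (\<Sum>t<M. cmod (\<Sum>j\<le>J. c' (\<omega> t) j * model_form V ((lift ^^ j) (X (\<omega> t) h)) (X (\<omega> t) k)))"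
      unfolding eq by (intro mult_left_mono norm_sum) auto
    also have "\<dots> \<le> (\<Sum>t<M. C * (Re (model_form V (X (\<omega> t) h) (X (\<omega> t) h)) + Re (model_form V (X (\<omega> t) k) (X (\<omega> t) k))))"
      unfolding sum_distrib_left by (intro sum_mono step \<omega>1)
    also have "\<dots> = C * (Re (\<Sum>t<M. model_form V (X (\<omega> t) h) (X (\<omega> t) h)) + Re (\<Sum>t<M. model_form V (X (\<omega> t) k) (X (\<omega> t) k)))"
      by (simp add: sum.distrib flip: sum_distrib_left)
    also have "\<dots> = M * (N * (C * ((norm h)\<^sup>2 + (norm k)\<^sup>2)))"
      unfolding avg0 by (simp add: algebra_simps)
    finally show "2 * cmod (\<Sum>i\<le>I. of_nat (N - i) * d i) \<le> N * (C * ((norm h)\<^sup>2 + (norm k)\<^sup>2))"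
      using M by simp
  qed
  then show ?thesis
    by (simp add: d_def)
qed

end

lemma scaleR_op_pow:
  fixes A :: "'a :: real_normed_vector \<Rightarrow>\<^sub>L 'a"
  shows "(blinfun_apply (c *\<^sub>R A) ^^ n) x = c ^ n *\<^sub>R (blinfun_apply A ^^ n) x"
proof (induction n)
  case (Suc n)
  have "(blinfun_apply (c *\<^sub>R A) ^^ Suc n) x = (c *\<^sub>R A) ((blinfun_apply (c *\<^sub>R A) ^^ n) x)"
    by (simp only: funpow.simps o_apply)
  also have "\<dots> = c ^ Suc n *\<^sub>R (blinfun_apply A ^^ Suc n) x"
    unfolding Suc by (simp add: blinfun.scaleR_left blinfun.scaleR_right)
  finally show ?case .
qed simp

lemma scaleC_scaleR: "c *c (t *\<^sub>R x) = t *\<^sub>R (c *c x :: 'a :: complex_hilbert_space)"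
  by (metis scaleC_of_real scaleC_scaleC mult.commute)

lemma cinner_scaleR_left: "cinner (t *\<^sub>R x) y = of_real t * cinner x y"
  by (metis scaleC_of_real cinner_scaleC_left)

lemma clinear_op_scaleR: "clinear_op A \<Longrightarrow> clinear_op (c *\<^sub>R A)"
  by (simp add: clinear_op_def blinfun.scaleR_left scaleC_scaleR)

text \<open>
  Replacing \<open>A\<close> by \<open>t A\<close> with \<open>t < 1\<close> makes the product a strict contraction after division by \<open>r\<close>;
  then \<open>t\<close> tends to 1.
\<close>

theorem ando_inequality:
  fixes c :: "nat \<Rightarrow> nat \<Rightarrow> complex"
  assumes lin: "clinear_op A" "clinear_op B" and comm: "A o\<^sub>L B = B o\<^sub>L A"
    and norms: "norm A \<le> r" "norm B \<le> r" and r: "r > 0"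
    and C: "\<And>z w. cmod z = r \<Longrightarrow> cmod w = r \<Longrightarrow> cmod (\<Sum>i\<le>I. \<Sum>j\<le>J. c i j * z ^ i * w ^ j) \<le> C"
  shows "2 * cmod (\<Sum>i\<le>I. \<Sum>j\<le>J. c i j * cinner ((blinfun_apply A ^^ i) ((blinfun_apply B ^^ j) h)) k) \<le> C * ((norm h)\<^sup>2 + (norm k)\<^sup>2)"
proof -
  define d where "d i j = c i j * cinner ((blinfun_apply A ^^ i) ((blinfun_apply B ^^ j) h)) k" for i j
  have strict: "2 * cmod (\<Sum>i\<le>I. \<Sum>j\<le>J. of_real (t ^ i) * d i j) \<le> C * ((norm h)\<^sup>2 + (norm k)\<^sup>2)"
    if t: "0 \<le> t" "t < 1" for t
  proof -
    define S1 S2 where "S1 = (t / r) *\<^sub>R A" and "S2 = (1 / r) *\<^sub>R B"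
    have n1: "norm S1 \<le> t"
      using norms(1) r t mult_left_mono[OF norms(1), of t] by (simp add: S1_def field_simps)
    have n2: "norm S2 \<le> 1"
      using norms(2) r by (simp add: S2_def field_simps)
    have n12: "norm (S1 o\<^sub>L S2) \<le> t"
      using norm_blinfun_compose[of S1 S2] mult_mono[OF n1 n2] t by simp
    interpret commuting_contractions S1 S2
    proof
      show "S1 o\<^sub>L S2 = S2 o\<^sub>L S1"
        by (simp add: S1_def S2_def bounded_bilinear.scaleR_left[OF bounded_bilinear_blinfun_compose]
            bounded_bilinear.scaleR_right[OF bounded_bilinear_blinfun_compose] comm)
    qed (use lin n1 n2 n12 t in \<open>auto simp: S1_def S2_def intro: clinear_op_scaleR\<close>)
    define c' where "c' i j = c i j * of_real (r ^ i * r ^ j)" for i j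
    have c'_C: "cmod (\<Sum>i\<le>I. \<Sum>j\<le>J. c' i j * z ^ i * w ^ j) \<le> C" if "cmod z = 1" "cmod w = 1" for z w
    proof -
      have "(\<Sum>i\<le>I. \<Sum>j\<le>J. c' i j * z ^ i * w ^ j)
        = (\<Sum>i\<le>I. \<Sum>j\<le>J. c i j * (of_real r * z) ^ i * (of_real r * w) ^ j)"
        by (simp add: c'_def power_mult_distrib mult_ac)
      then show ?thesis
        using C[of "of_real r * z" "of_real r * w"] that r by (simp add: norm_mult)
    qed
    have "c' i j * cinner ((blinfun_apply S1 ^^ i) ((blinfun_apply S2 ^^ j) h)) k = of_real (t ^ i) * d i j" for i j
    proof -
      have lin_pow: "(blinfun_apply A ^^ i) (s *\<^sub>R x) = s *\<^sub>R (blinfun_apply A ^^ i) x" for s x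
        by (induction i) (auto simp: blinfun.scaleR_right)
      have "(blinfun_apply S1 ^^ i) ((blinfun_apply S2 ^^ j) h) = ((t / r) ^ i * (1 / r) ^ j) *\<^sub>R (blinfun_apply A ^^ i) ((blinfun_apply B ^^ j) h)"
        by (simp add: S1_def S2_def scaleR_op_pow lin_pow)
      then show ?thesis
        using r by (simp add: c'_def d_def cinner_scaleR_left power_divide)
    qed
    then show ?thesis
      using ando_inequality_strict[where I = I and J = J and c = c' and C = C and h = h and k = k] c'_C by simp
  qed
  have "2 * cmod (\<Sum>i\<le>I. \<Sum>j\<le>J. d i j) \<le> C * ((norm h)\<^sup>2 + (norm k)\<^sup>2)"
  proof (rule LIMSEQ_le_const2)
    define t where "t n = real n / real (Suc n)" for n
    have "(\<lambda>n. 2 * cmod (\<Sum>i\<le>I. \<Sum>j\<le>J. of_real (t n ^ i) * d i j))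
        \<longlonglongrightarrow> 2 * cmod (\<Sum>i\<le>I. \<Sum>j\<le>J. of_real (1 ^ i) * d i j)"
      unfolding t_def by (intro tendsto_intros LIMSEQ_n_over_Suc_n)
    then show "(\<lambda>n. 2 * cmod (\<Sum>i\<le>I. \<Sum>j\<le>J. of_real (t n ^ i) * d i j))
        \<longlonglongrightarrow> 2 * cmod (\<Sum>i\<le>I. \<Sum>j\<le>J. d i j)"
      by simp
    show "\<exists>N. \<forall>n\<ge>N. 2 * cmod (\<Sum>i\<le>I. \<Sum>j\<le>J. of_real (t n ^ i) * d i j) \<le> C * ((norm h)\<^sup>2 + (norm k)\<^sup>2)"
      by (intro exI allI impI strict) (auto simp: t_def)
  qed
  then show ?thesis
    by (simp add: d_def)
qed

section \<open>The analytic part of a Laurent polynomial\<close>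

lemma bessel_circle:
  fixes a :: "int \<Rightarrow> complex"
  assumes \<rho>: "\<rho> > 0" and C: "\<And>z. cmod z = \<rho> \<Longrightarrow> cmod (\<Sum>n=-int N..int N. a n * z powi n) \<le> C"
  shows "(\<Sum>n=-int N..int N. (cmod (a n) * \<rho> powi n)\<^sup>2) \<le> C\<^sup>2"
proof -
  (* The differences m - n of two exponents have modulus at most 2 N. *)
  define M where "M = 2 * N + 1"
  define \<omega> where "\<omega> t = cis (2 * pi * real t / real M)" for t :: nat
  define b where "b n = a n * of_real (\<rho> powi n)" for n
  define f where "f t = (\<Sum>n=-int N..int N. b n * \<omega> t powi n)" for t
  have f_le: "cmod (f t) \<le> C" for t
  proof -
    have "f t = (\<Sum>n=-int N..int N. a n * (of_real \<rho> * \<omega> t) powi n)"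
      by (simp add: f_def b_def power_int_mult_distrib mult.assoc)
    then show ?thesis
      using C[of "of_real \<rho> * \<omega> t"] \<rho> by (simp add: \<omega>_def norm_mult)
  qed
  have ff: "f t * cnj (f t) = (\<Sum>m=-int N..int N. \<Sum>n=-int N..int N. b m * cnj (b n) * \<omega> t powi (m - n))" for t
  proof -
    have "\<omega> t powi (m - n) = \<omega> t powi m * cnj (\<omega> t powi n)" for m n
      by (simp add: \<omega>_def cis_power_int cis_cnj cis_mult diff_divide_distrib algebra_simps)
    then show ?thesis
      by (simp add: f_def cnj_sum sum_product mult_ac)
  qed
  have "(\<Sum>t<M. f t * cnj (f t)) = (\<Sum>m=-int N..int N. \<Sum>t<M. \<Sum>n=-int N..int N. b m * cnj (b n) * \<omega> t powi (m - n))"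
    unfolding ff by (rule sum.swap)
  also have "\<dots> = (\<Sum>m=-int N..int N. \<Sum>n=-int N..int N. \<Sum>t<M. b m * cnj (b n) * \<omega> t powi (m - n))"
    by (rule sum.cong[OF refl], rule sum.swap)
  also have "\<dots> = (\<Sum>m=-int N..int N. \<Sum>n=-int N..int N. if n = m then of_nat M * (b m * cnj (b m)) else 0)"
  proof (rule sum.cong[OF refl], rule sum.cong[OF refl])
    fix m n assume "m \<in> {-int N..int N}" "n \<in> {-int N..int N}"
    then have "\<bar>m - n\<bar> < int M"
      by (auto simp: M_def)
    then have "(\<Sum>t<M. \<omega> t powi (m - n)) = (if m - n = 0 then of_nat M else 0)"
      unfolding \<omega>_def by (rule sum_roots_of_unity)
    then show "(\<Sum>t<M. b m * cnj (b n) * \<omega> t powi (m - n)) = (if n = m then of_nat M * (b m * cnj (b m)) else 0)"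
      by (simp flip: sum_distrib_left)
  qed
  also have "\<dots> = (\<Sum>m=-int N..int N. of_nat M * (b m * cnj (b m)))"
    by (rule sum.cong) auto
  also have "\<dots> = of_real (M * (\<Sum>m=-int N..int N. (cmod (b m))\<^sup>2))"
    by (simp add: sum_distrib_left flip: complex_norm_square)
  also have "(\<Sum>t<M. f t * cnj (f t)) = of_real (\<Sum>t<M. (cmod (f t))\<^sup>2)"
    by (simp flip: complex_norm_square)
  finally have "M * (\<Sum>m=-int N..int N. (cmod (b m))\<^sup>2) = (\<Sum>t<M. (cmod (f t))\<^sup>2)"
    by (metis of_real_eq_iff)
  also have "\<dots> \<le> (\<Sum>t<M. C\<^sup>2)"
    by (intro sum_mono power_mono f_le) simp
  finally have "(\<Sum>m=-int N..int N. (cmod (b m))\<^sup>2) \<le> C\<^sup>2"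
    by (simp add: M_def del: of_nat_add of_nat_mult of_nat_Suc)
  then show ?thesis
    using \<rho> by (simp add: b_def norm_mult norm_power_int)
qed

text \<open>
  The constant term belongs equally to the analytic and the coanalytic part. Any other division would make
  the two parts satisfy different bounds, and the sum of the bounds would be larger.
\<close>

definition half_at_zero :: "nat \<Rightarrow> real"
  where "half_at_zero n = (if n = 0 then 1 / 2 else 1)"

lemma sum_symmetric_split:
  fixes g :: "int \<Rightarrow> 'b :: real_vector"
  shows "(\<Sum>n=-int N..int N. g n) = (\<Sum>n\<le>N. half_at_zero n *\<^sub>R g (int n)) + (\<Sum>n\<le>N. half_at_zero n *\<^sub>R g (- int n))"
proof (induction N)
  case 0
  then show ?case
    by (simp add: half_at_zero_def flip: scaleR_add_left)
next
  case (Suc N)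
  have "{-int (Suc N)..int (Suc N)} = insert (int (Suc N)) (insert (- int (Suc N)) {-int N..int N})"
    by auto
  then have "(\<Sum>n=-int (Suc N)..int (Suc N). g n) = g (int (Suc N)) + (g (- int (Suc N)) + (\<Sum>n=-int N..int N. g n))"
    by (simp del: of_nat_Suc)
  then show ?case
    unfolding Suc by (simp add: half_at_zero_def algebra_simps del: of_nat_Suc)
qed

definition shields_const :: "real \<Rightarrow> real"
  where "shields_const r = sqrt ((r\<^sup>2 + 1) / (r\<^sup>2 - 1))"

text \<open>
  The sum is at most \<open>1/4 + 1/(r\<^sup>4 - 1)\<close>, and \<open>(r\<^sup>2 + 1) / (r\<^sup>2 - 1) / 4 = 1/4 + 1/(2 (r\<^sup>2 - 1))\<close>. Since
  \<open>r\<^sup>4 - 1 = (r\<^sup>2 - 1) (r\<^sup>2 + 1)\<close>, the comparison amounts to \<open>r\<^sup>2 + 1 \<ge> 2\<close>.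
\<close>

lemma sum_half_weights_le:
  assumes "r > 1"
  shows "(\<Sum>n\<le>N. (half_at_zero n * (1 / r) ^ (2 * n))\<^sup>2) \<le> (shields_const r / 2)\<^sup>2"
proof -
  define q where "q = (1 / r) ^ 4"
  have r2: "r\<^sup>2 > 1" using assms by simp
  have q: "0 < q" "q < 1"
    using assms by (auto simp: q_def power_less_one_iff)
  have "(\<Sum>n\<le>N. (half_at_zero n * (1 / r) ^ (2 * n))\<^sup>2) = 1 / 4 + q * (1 - q ^ N) / (1 - q)"
  proof (induction N)
    case 0
    then show ?case by (simp add: half_at_zero_def power2_eq_square)
  next
    case (Suc N)
    have "((1 / r) ^ (2 * Suc N))\<^sup>2 = q ^ Suc N"
      unfolding q_def power_mult[symmetric] by (rule arg_cong[where f = "\<lambda>k. (1 / r) ^ k"]) simp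
    then have "(\<Sum>n\<le>Suc N. (half_at_zero n * (1 / r) ^ (2 * n))\<^sup>2) = 1 / 4 + q * (1 - q ^ N) / (1 - q) + q ^ Suc N"
      using Suc by (simp add: half_at_zero_def)
    also have "\<dots> = 1 / 4 + q * (1 - q ^ Suc N) / (1 - q)"
      using q by (simp add: field_simps)
    finally show ?case .
  qed
  also have "\<dots> \<le> 1 / 4 + q / (1 - q)"
    using q by (intro add_left_mono divide_right_mono) auto
  also have "q / (1 - q) = 1 / (r ^ 4 - 1)"
    using assms by (simp add: q_def field_simps)
  also have "r ^ 4 - 1 = (r\<^sup>2 - 1) * (r\<^sup>2 + 1)"
    by (simp add: algebra_simps flip: power_add)
  also have "1 / 4 + 1 / ((r\<^sup>2 - 1) * (r\<^sup>2 + 1)) \<le> 1 / 4 + 1 / ((r\<^sup>2 - 1) * 2)"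
    using r2 by (intro add_left_mono divide_left_mono mult_left_mono mult_pos_pos) auto
  also have "\<dots> = ((r\<^sup>2 + 1) / (r\<^sup>2 - 1)) / 4"
    using r2 by (simp add: field_simps)
  also have "\<dots> = (shields_const r / 2)\<^sup>2"
    using r2 by (simp add: shields_const_def power_divide)
  finally show ?thesis .
qed

text \<open>
  On \<open>|z| = r\<close> the coanalytic part is dominated by \<open>\<Sum> half_at_zero n |a(-n)| r\<^sup>-\<^sup>n\<close>, and Bessel's inequality
  on the opposite circle controls \<open>\<Sum> |a(-n)|\<^sup>2 r\<^sup>2\<^sup>n\<close>. The Cauchy--Schwarz inequality leaves the weights
  \<open>half_at_zero n r\<^sup>-\<^sup>2\<^sup>n\<close>.
\<close>

lemma analytic_part_bound:
  fixes a :: "int \<Rightarrow> complex"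
  assumes r: "r > 1"
    and C: "\<And>z. cmod z = r \<or> cmod z = 1 / r \<Longrightarrow> cmod (\<Sum>n=-int N..int N. a n * z powi n) \<le> C"
    and z: "cmod z = r"
  shows "cmod (\<Sum>n\<le>N. of_real (half_at_zero n) * a (int n) * z ^ n) \<le> (1 + shields_const r / 2) * C"
proof -
  have C0: "C \<ge> 0"
    using C[of z] z norm_ge_zero order_trans by blast
  have sh: "shields_const r \<ge> 0"
    using r by (simp add: shields_const_def)
  define u where "u n = cmod (a (- int n)) * r ^ n" for n
  define v where "v n = half_at_zero n * (1 / r) ^ (2 * n)" for n
  have "(\<Sum>n\<le>N. (u n)\<^sup>2) \<le> (\<Sum>n=-int N..int N. (cmod (a n) * (1 / r) powi n)\<^sup>2)"
  proof -
    have "(\<Sum>n\<le>N. (u n)\<^sup>2) = (\<Sum>n\<in>(\<lambda>n. - int n) ` {..N}. (cmod (a n) * (1 / r) powi n)\<^sup>2)"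
      using r by (subst sum.reindex) (auto simp: inj_on_def u_def power_int_minus power_one_over)
    also have "\<dots> \<le> (\<Sum>n=-int N..int N. (cmod (a n) * (1 / r) powi n)\<^sup>2)"
      by (rule sum_mono2) auto
    finally show ?thesis .
  qed
  also have "\<dots> \<le> C\<^sup>2"
    using r by (intro bessel_circle C) auto
  finally have u: "(\<Sum>n\<le>N. (u n)\<^sup>2) \<le> C\<^sup>2" .
  have v: "(\<Sum>n\<le>N. (v n)\<^sup>2) \<le> (shields_const r / 2)\<^sup>2"
    unfolding v_def by (rule sum_half_weights_le[OF r])
  have "(\<Sum>n\<le>N. u n * v n)\<^sup>2 \<le> (\<Sum>n\<le>N. (u n)\<^sup>2) * (\<Sum>n\<le>N. (v n)\<^sup>2)"
    by (rule Cauchy_Schwarz_ineq_sum)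
  also have "\<dots> \<le> C\<^sup>2 * (shields_const r / 2)\<^sup>2"
    by (intro mult_mono u v sum_nonneg) auto
  finally have uv: "(\<Sum>n\<le>N. u n * v n) \<le> C * (shields_const r / 2)"
    unfolding power_mult_distrib[symmetric]
    by (rule power2_le_imp_le) (intro mult_nonneg_nonneg C0 divide_nonneg_nonneg sh zero_le_numeral)
  have "cmod (\<Sum>n\<le>N. half_at_zero n *\<^sub>R (a (- int n) * z powi (- int n)))
      \<le> (\<Sum>n\<le>N. cmod (half_at_zero n *\<^sub>R (a (- int n) * z powi (- int n))))"
    by (rule norm_sum)
  also have "\<dots> = (\<Sum>n\<le>N. u n * v n)"
  proof (rule sum.cong[OF refl])
    fix n
    have "(1 / r) ^ n = (r * (1 / r)) ^ n * (1 / r) ^ n"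
      using r by simp
    also have "\<dots> = r ^ n * (1 / r) ^ (2 * n)"
      by (simp only: power_mult_distrib mult_2 power_add mult.assoc)
    finally have eq: "(1 / r) ^ n = r ^ n * (1 / r) ^ (2 * n)" .
    have "cmod (half_at_zero n *\<^sub>R (a (- int n) * z powi (- int n))) = half_at_zero n * (cmod (a (- int n)) * (1 / r) ^ n)"
      unfolding norm_scaleR norm_mult power_int_minus power_int_of_nat norm_inverse norm_power z
      by (simp add: half_at_zero_def power_one_over inverse_eq_divide)
    also have "\<dots> = u n * v n"
      by (simp only: u_def v_def eq mult_ac)
    finally show "cmod (half_at_zero n *\<^sub>R (a (- int n) * z powi (- int n))) = u n * v n" .
  qed
  finally have minus: "cmod (\<Sum>n\<le>N. half_at_zero n *\<^sub>R (a (- int n) * z powi (- int n))) \<le> C * (shields_const r / 2)"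
    using uv by linarith
  have "(\<Sum>n\<le>N. of_real (half_at_zero n) * a (int n) * z ^ n)
    = (\<Sum>n=-int N..int N. a n * z powi n) - (\<Sum>n\<le>N. half_at_zero n *\<^sub>R (a (- int n) * z powi (- int n)))"
    by (simp add: sum_symmetric_split scaleR_conv_of_real mult.assoc)
  also have "cmod \<dots> \<le> C + C * (shields_const r / 2)"
    using minus C[of z] z by (intro order_trans[OF norm_triangle_ineq4] add_mono) auto
  finally show ?thesis
    by (simp add: algebra_simps)
qed

lemma analytic_part_bound_two_variables:
  fixes a :: "int \<Rightarrow> int \<Rightarrow> complex"
  assumes r: "r > 1"
    and C: "\<And>z w. cmod z = r \<or> cmod z = 1 / r \<Longrightarrow> cmod w = r \<or> cmod w = 1 / r \<Longrightarrow>
      cmod (\<Sum>m=-int N..int N. \<Sum>n=-int N..int N. a m n * z powi m * w powi n) \<le> C"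
    and z: "cmod z = r" and w: "cmod w = r"
  shows "cmod (\<Sum>i\<le>N. \<Sum>j\<le>N. of_real (half_at_zero i * half_at_zero j) * a (int i) (int j) * z ^ i * w ^ j)
    \<le> (1 + shields_const r / 2)\<^sup>2 * C"
proof -
  define b where "b n = (\<Sum>i\<le>N. of_real (half_at_zero i) * a (int i) n * z ^ i)" for n
  have step: "cmod (\<Sum>n=-int N..int N. b n * w powi n) \<le> (1 + shields_const r / 2) * C"
    if w: "cmod w = r \<or> cmod w = 1 / r" for w
  proof -
    (* For fixed w this is a Laurent polynomial in z alone, with these coefficients. *)
    define a' where "a' m = (\<Sum>n=-int N..int N. a m n * w powi n)" for m
    have "(\<Sum>n=-int N..int N. b n * w powi n)
      = (\<Sum>n=-int N..int N. \<Sum>i\<le>N. of_real (half_at_zero i) * a (int i) n * z ^ i * w powi n)"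
      by (simp add: b_def sum_distrib_right)
    also have "\<dots> = (\<Sum>i\<le>N. \<Sum>n=-int N..int N. of_real (half_at_zero i) * a (int i) n * z ^ i * w powi n)"
      by (rule sum.swap)
    also have "\<dots> = (\<Sum>i\<le>N. of_real (half_at_zero i) * a' (int i) * z ^ i)"
      by (simp add: a'_def sum_distrib_left sum_distrib_right mult_ac)
    also have "cmod \<dots> \<le> (1 + shields_const r / 2) * C"
    proof (rule analytic_part_bound[OF r _ z])
      fix z assume "cmod z = r \<or> cmod z = 1 / r"
      moreover have "(\<Sum>m=-int N..int N. a' m * z powi m)
        = (\<Sum>m=-int N..int N. \<Sum>n=-int N..int N. a m n * z powi m * w powi n)"
        by (simp add: a'_def sum_distrib_left sum_distrib_right mult_ac)
      ultimately show "cmod (\<Sum>m=-int N..int N. a' m * z powi m) \<le> C"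
        using C[of z w] w by simp
    qed
    finally show ?thesis .
  qed
  have "(\<Sum>i\<le>N. \<Sum>j\<le>N. of_real (half_at_zero i * half_at_zero j) * a (int i) (int j) * z ^ i * w ^ j)
    = (\<Sum>j\<le>N. \<Sum>i\<le>N. of_real (half_at_zero i * half_at_zero j) * a (int i) (int j) * z ^ i * w ^ j)"
    by (rule sum.swap)
  also have "\<dots> = (\<Sum>j\<le>N. of_real (half_at_zero j) * b (int j) * w ^ j)"
    by (simp add: b_def sum_distrib_left sum_distrib_right mult_ac)
  also have "cmod \<dots> \<le> (1 + shields_const r / 2) * ((1 + shields_const r / 2) * C)"
    by (rule analytic_part_bound[OF r step w])
  finally show ?thesis
    by (simp add: power2_eq_square mult.assoc)
qed

section \<open>The bound for Laurent polynomials of the two operators\<close>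

lemma op_power_0 [simp]: "op_power T 0 = id_blinfun"
  by (simp add: op_power_def)

lemma op_power_Suc: "op_power T (Suc n) = T o\<^sub>L op_power T n"
  by (simp add: op_power_def)

lemma op_power_apply: "op_power T n x = (blinfun_apply T ^^ n) x"
  by (induction n) (auto simp: op_power_Suc)

definition op_powi :: "('a :: real_normed_vector \<Rightarrow>\<^sub>L 'a) \<Rightarrow> int \<Rightarrow> ('a \<Rightarrow>\<^sub>L 'a)"
  where "op_powi T m = (if 0 \<le> m then op_power T (nat m) else op_power (op_inverse T) (nat (- m)))"

lemma is_op_inverse_op_inverse: "invertible_op T \<Longrightarrow> is_op_inverse T (op_inverse T)"
  using op_inverse_eq unfolding invertible_op_def by metis

lemma op_inverse_left: "invertible_op T \<Longrightarrow> op_inverse T (T x) = x"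
  and op_inverse_right: "invertible_op T \<Longrightarrow> T (op_inverse T x) = x"
  using is_op_inverse_op_inverse[of T]
  by (metis is_op_inverse_def blinfun_apply_blinfun_compose blinfun_apply_id_blinfun id_apply)+

lemma op_powi_succ:
  assumes "invertible_op T"
  shows "op_powi T (m + 1) x = T (op_powi T m x)"
proof (cases "m \<ge> 0")
  case True
  then have "nat (m + 1) = Suc (nat m)" by simp
  then show ?thesis
    using True by (simp add: op_powi_def op_power_Suc)
next
  case False
  define k where "k = nat (- m - 1)"
  have m: "m = - int (Suc k)"
    using False by (simp add: k_def)
  show ?thesis
    using assms by (cases "k = 0") (auto simp: m op_powi_def op_power_Suc op_inverse_right nat_add_distrib)
qed

lemma op_powi_pred:
  assumes "invertible_op T"
  shows "op_powi T (m - 1) x = op_inverse T (op_powi T m x)"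
  using op_powi_succ[OF assms, of "m - 1" x] by (simp add: op_inverse_left assms)

lemma op_powi_0 [simp]: "op_powi T 0 = id_blinfun"
  by (simp add: op_powi_def)

lemma op_powi_add:
  assumes "invertible_op T"
  shows "op_powi T (m + n) x = op_powi T m (op_powi T n x)"
proof (induction m rule: int_induct[where k = 0])
  case (step1 i)
  then show ?case
    using op_powi_succ[OF assms, of "i + n" x] op_powi_succ[OF assms, of i] by (simp add: algebra_simps)
next
  case (step2 i)
  then show ?case
    using op_powi_pred[OF assms, of "i + n" x] op_powi_pred[OF assms, of i] by (simp add: algebra_simps)
qed simp

lemma clinear_op_inverse:
  assumes "clinear_op T" "invertible_op T"
  shows "clinear_op (op_inverse T)"
  unfolding clinear_op_def
proof (intro allI)
  fix c x
  have "T (c *c op_inverse T x) = c *c x"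
    using assms by (simp add: clinear_op_def op_inverse_right)
  then show "op_inverse T (c *c x) = c *c op_inverse T x"
    by (metis assms(2) op_inverse_left)
qed

lemma clinear_op_powi:
  assumes "clinear_op T" "invertible_op T"
  shows "op_powi T m (c *c x) = c *c op_powi T m x"
  using clinear_op_pow[OF assms(1)] clinear_op_pow[OF clinear_op_inverse[OF assms]]
  by (auto simp: op_powi_def op_power_apply)

lemma commute_op_inverse:
  fixes S T :: "'a :: real_normed_vector \<Rightarrow>\<^sub>L 'a"
  assumes "invertible_op T" "\<And>x. T (S x) = S (T x)"
  shows "op_inverse T (S x) = S (op_inverse T x)"
  by (metis assms op_inverse_left op_inverse_right)

lemma commute_op_powi:
  fixes S :: "'a \<Rightarrow>\<^sub>L 'a :: real_normed_vector"
  assumes "invertible_op T" and "\<And>x. T (S x) = S (T x)"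
  shows "op_powi T m (S x) = S (op_powi T m x)"
proof -
  have *: "(blinfun_apply U ^^ k) (S x) = S ((blinfun_apply U ^^ k) x)" if "\<And>x. U (S x) = S (U x)" for U :: "'a \<Rightarrow>\<^sub>L 'a" and k
    using that by (induction k) auto
  show ?thesis
    using *[OF assms(2)] *[OF commute_op_inverse[OF assms]]
    by (auto simp: op_powi_def op_power_apply)
qed

text \<open>
  The additive estimate becomes multiplicative by choosing \<open>k\<close> parallel to \<open>G h\<close> and of the same norm as
  \<open>h\<close>.
\<close>

lemma norm_le_of_cinner_bound:
  fixes G :: "'a :: complex_hilbert_space \<Rightarrow>\<^sub>L 'a"
  assumes "K \<ge> 0" and "\<And>h k. 2 * cmod (cinner (G h) k) \<le> K * ((norm h)\<^sup>2 + (norm k)\<^sup>2)"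
  shows "norm G \<le> K"
proof (rule norm_blinfun_bound[OF \<open>K \<ge> 0\<close>])
  fix h
  show "norm (G h) \<le> K * norm h"
  proof (cases "h = 0 \<or> G h = 0")
    case True
    then show ?thesis using \<open>K \<ge> 0\<close> by auto
  next
    case False
    define k where "k = (norm h / norm (G h)) *\<^sub>R G h"
    have "cinner (G h) k = of_real (norm h / norm (G h)) * cinner (G h) (G h)"
      by (simp only: k_def scaleC_of_real[symmetric] cinner_scaleC_right complex_cnj_complex_of_real)
    also have "\<dots> = of_real (norm h * norm (G h))"
      unfolding cinner_self using False by (simp add: power2_eq_square)
    finally have "cmod (cinner (G h) k) = norm h * norm (G h)"
      by (simp only: norm_of_real) simp
    moreover have "norm k = norm h"
      using False by (simp add: k_def)
    ultimately have "norm h * norm (G h) \<le> norm h * (K * norm h)"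
      using assms(2)[of h k] by (simp add: power2_eq_square mult_ac)
    then show ?thesis
      using False by simp
  qed
qed

definition closed_annulus :: "real \<Rightarrow> complex set"
  where "closed_annulus r = {z. 1 / r \<le> cmod z \<and> cmod z \<le> r}"

locale annulus_pair =
  fixes r :: real and T1 T2 :: "'a :: complex_hilbert_space \<Rightarrow>\<^sub>L 'a"
  assumes r: "r > 1" and lin1: "clinear_op T1" and lin2: "clinear_op T2"
    and comm: "T1 o\<^sub>L T2 = T2 o\<^sub>L T1"
    and inv1: "invertible_op T1" and inv2: "invertible_op T2"
    and norm1: "norm T1 \<le> r" and norm2: "norm T2 \<le> r"
    and norm1': "norm (op_inverse T1) \<le> r" and norm2': "norm (op_inverse T2) \<le> r"
begin

abbreviation "X \<equiv> closed_annulus r \<times> closed_annulus r"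

definition monomial_op :: "complex \<Rightarrow> int \<Rightarrow> int \<Rightarrow> ('a \<Rightarrow>\<^sub>L 'a)"
  where "monomial_op c m n = scalar_op c o\<^sub>L op_powi T1 m o\<^sub>L op_powi T2 n"

text \<open>
  A Laurent polynomial function on the closed biannulus together with the operator that it represents. As a relation
  it makes no claim that the function determines the operator; this follows afterwards from
  the norm estimate. Functions matter only on the biannulus, where the coordinates do not vanish.
\<close>

inductive laurent :: "(complex \<times> complex \<Rightarrow> complex) \<Rightarrow> ('a \<Rightarrow>\<^sub>L 'a) \<Rightarrow> bool"
  where
    monomial: "(\<And>z w. (z, w) \<in> X \<Longrightarrow> f (z, w) = c * z powi m * w powi n) \<Longrightarrow> laurent f (monomial_op c m n)"
  | add: "laurent f F \<Longrightarrow> laurent g G \<Longrightarrow> (\<And>x. x \<in> X \<Longrightarrow> h x = f x + g x) \<Longrightarrow> laurent h (F + G)"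

lemma monomial_op_apply: "monomial_op c m n x = c *c op_powi T1 m (op_powi T2 n x)"
  by (simp add: monomial_op_def scalar_op.rep_eq)

lemma commute_T1_T2: "T1 (T2 x) = T2 (T1 x)"
  by (metis comm blinfun_apply_blinfun_compose)

lemma commute_powi: "op_powi T1 m (op_powi T2 n x) = op_powi T2 n (op_powi T1 m x)"
  by (intro commute_op_powi inv1 inv2 commute_op_powi[OF inv2, symmetric] commute_T1_T2[symmetric])

lemma monomial_op_mult: "monomial_op c m n o\<^sub>L monomial_op d m' n' = monomial_op (c * d) (m + m') (n + n')"
proof (rule blinfun_eqI)
  fix x
  have "monomial_op (c * d) (m + m') (n + n') x = c *c d *c op_powi T1 m (op_powi T1 m' (op_powi T2 n (op_powi T2 n' x)))"
    by (simp add: monomial_op_apply op_powi_add inv1 inv2 scaleC_scaleC)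
  also have "\<dots> = (monomial_op c m n o\<^sub>L monomial_op d m' n') x"
    using lin1 lin2 inv1 inv2 by (simp add: monomial_op_apply commute_powi clinear_op_powi)
  finally show "(monomial_op c m n o\<^sub>L monomial_op d m' n') x = monomial_op (c * d) (m + m') (n + n') x" ..
qed

lemma monomial_op_0: "monomial_op 0 m n = 0"
  by (rule blinfun_eqI) (simp add: monomial_op_apply)

lemma closed_annulus_nonzero: "z \<in> closed_annulus r \<Longrightarrow> z \<noteq> 0"
  using r by (auto simp: closed_annulus_def)

lemma laurent_mult:
  assumes "laurent f F" "laurent g G"
  shows "laurent (\<lambda>x. f x * g x) (F o\<^sub>L G)"
  using assms(1)
proof induction
  case (monomial f c m n)
  from assms(2) show ?case
  proof induction
    case (monomial g d m' n')
    show ?case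
      unfolding monomial_op_mult
    proof (rule laurent.monomial)
      fix z w assume zw: "(z, w) \<in> X"
      then show "f (z, w) * g (z, w) = c * d * z powi (m + m') * w powi (n + n')"
        using closed_annulus_nonzero monomial[OF zw] \<open>(z, w) \<in> X \<Longrightarrow> f (z, w) = c * z powi m * w powi n\<close>
        by (auto simp: power_int_add)
    qed
  next
    case (add g1 G1 g2 G2 h)
    show ?case
      unfolding bounded_bilinear.add_right[OF bounded_bilinear_blinfun_compose]
      by (rule laurent.add[OF add.IH]) (simp add: add.hyps distrib_left)
  qed
next
  case (add f1 F1 f2 F2 h)
  show ?case
    unfolding bounded_bilinear.add_left[OF bounded_bilinear_blinfun_compose]
    by (rule laurent.add[OF add.IH]) (simp add: add.hyps distrib_right)
qed

lemma laurent_zero: "laurent (\<lambda>x. 0) 0"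
  using laurent.monomial[of "\<lambda>x. 0" 0 0 0] by (simp add: monomial_op_0)

lemma laurent_sum: "finite A \<Longrightarrow> (\<And>i. i \<in> A \<Longrightarrow> laurent (f i) (F i)) \<Longrightarrow> laurent (\<lambda>x. \<Sum>i\<in>A. f i x) (\<Sum>i\<in>A. F i)"
proof (induction A rule: finite_induct)
  case empty
  then show ?case by (simp add: laurent_zero)
next
  case (insert i A)
  show ?case
    using insert.hyps by (simp, intro laurent.add[of "f i" _ "\<lambda>x. \<Sum>i\<in>A. f i x"] insert.IH insert.prems) auto
qed

lemma laurent_eval2: "laurent (eval2 p) (eval2_op p T1 T2)"
proof -
  have "laurent (\<lambda>x. \<Sum>i\<le>degree p. \<Sum>j\<le>degree (coeff p i). coeff (coeff p i) j * fst x powi int i * snd x powi int j)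
    (\<Sum>i\<le>degree p. \<Sum>j\<le>degree (coeff p i). monomial_op (coeff (coeff p i) j) (int i) (int j))"
    by (intro laurent_sum laurent.monomial) auto
  moreover have "eval2 p = (\<lambda>x. \<Sum>i\<le>degree p. \<Sum>j\<le>degree (coeff p i). coeff (coeff p i) j * fst x powi int i * snd x powi int j)"
    by (rule ext) (metis (no_types, lifting) eval2_eq_sum power_int_of_nat prod.collapse sum.cong)
  moreover have "monomial_op c (int i) (int j) = scalar_op c o\<^sub>L op_power T1 i o\<^sub>L op_power T2 j" for c i j
    by (simp add: monomial_op_def op_powi_def)
  ultimately show ?thesis
    by (simp add: eval2_op_def)
qed

text \<open>
  A single coefficient family serves all square index ranges beyond some size, so that two representations can
  be added without padding.
\<close>

lemma laurent_normal_form: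
  assumes "laurent f F"
  obtains N a where
    "\<And>M z w. M \<ge> N \<Longrightarrow> (z, w) \<in> X \<Longrightarrow>
       f (z, w) = (\<Sum>m=-int M..int M. \<Sum>n=-int M..int M. a m n * z powi m * w powi n)"
    "\<And>M. M \<ge> N \<Longrightarrow> F = (\<Sum>m=-int M..int M. \<Sum>n=-int M..int M. monomial_op (a m n) m n)"
  using assms
proof (induction arbitrary: thesis)
  case (monomial f c m n)
  define a where "a m' n' = (if m' = m then if n' = n then c else 0 else 0)" for m' n'
  show ?case
  proof (rule monomial(2)[of "nat (max \<bar>m\<bar> \<bar>n\<bar>)" a])
    fix M z w assume M: "nat (max \<bar>m\<bar> \<bar>n\<bar>) \<le> M" and "(z, w) \<in> X"
    have mn: "m \<in> {-int M..int M}" "n \<in> {-int M..int M}"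
      using M by auto
    have "(\<Sum>m'=-int M..int M. \<Sum>n'=-int M..int M. a m' n' * z powi m' * w powi n')
      = (\<Sum>m'=-int M..int M. if m' = m then c * z powi m * w powi n else 0)"
    proof (rule sum.cong[OF refl])
      fix m'
      have "(\<Sum>n'=-int M..int M. a m' n' * z powi m' * w powi n')
        = (\<Sum>n'=-int M..int M. if n' = n then if m' = m then c * z powi m * w powi n else 0 else 0)"
        by (rule sum.cong) (auto simp: a_def)
      then show "(\<Sum>n'=-int M..int M. a m' n' * z powi m' * w powi n') = (if m' = m then c * z powi m * w powi n else 0)"
        using mn by (simp add: sum.delta)
    qed
    also have "\<dots> = f (z, w)"
      using mn monomial(1)[OF \<open>(z, w) \<in> X\<close>] by (simp add: sum.delta)
    finally show "f (z, w) = (\<Sum>m=-int M..int M. \<Sum>n=-int M..int M. a m n * z powi m * w powi n)" ..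
  next
    fix M assume M: "nat (max \<bar>m\<bar> \<bar>n\<bar>) \<le> M"
    have mn: "m \<in> {-int M..int M}" "n \<in> {-int M..int M}"
      using M by auto
    have "(\<Sum>m'=-int M..int M. \<Sum>n'=-int M..int M. monomial_op (a m' n') m' n')
      = (\<Sum>m'=-int M..int M. if m' = m then monomial_op c m n else 0)"
    proof (rule sum.cong[OF refl])
      fix m'
      have "(\<Sum>n'=-int M..int M. monomial_op (a m' n') m' n')
        = (\<Sum>n'=-int M..int M. if n' = n then if m' = m then monomial_op c m n else 0 else 0)"
        by (rule sum.cong) (auto simp: a_def monomial_op_0)
      then show "(\<Sum>n'=-int M..int M. monomial_op (a m' n') m' n') = (if m' = m then monomial_op c m n else 0)"
        using mn by (simp add: sum.delta)
    qed
    also have "\<dots> = monomial_op c m n"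
      using mn by (simp add: sum.delta)
    finally show "monomial_op c m n = (\<Sum>m'=-int M..int M. \<Sum>n'=-int M..int M. monomial_op (a m' n') m' n')" ..
  qed
next
  case (add f F g G h)
  obtain N a where a:
    "\<And>M z w. M \<ge> N \<Longrightarrow> (z, w) \<in> X \<Longrightarrow>
       f (z, w) = (\<Sum>m=-int M..int M. \<Sum>n=-int M..int M. a m n * z powi m * w powi n)"
    "\<And>M. M \<ge> N \<Longrightarrow> F = (\<Sum>m=-int M..int M. \<Sum>n=-int M..int M. monomial_op (a m n) m n)"
    by (rule add.IH(1)) blast
  obtain N' b where b:
    "\<And>M z w. M \<ge> N' \<Longrightarrow> (z, w) \<in> X \<Longrightarrow>
       g (z, w) = (\<Sum>m=-int M..int M. \<Sum>n=-int M..int M. b m n * z powi m * w powi n)"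
    "\<And>M. M \<ge> N' \<Longrightarrow> G = (\<Sum>m=-int M..int M. \<Sum>n=-int M..int M. monomial_op (b m n) m n)"
    by (rule add.IH(2)) blast
  have *: "monomial_op (c + d) m n = monomial_op c m n + monomial_op d m n" for c d m n
    by (rule blinfun_eqI) (simp add: monomial_op_apply scaleC_add_left blinfun.add_left)
  show ?case
  proof (rule add.prems[of "max N N'" "\<lambda>m n. a m n + b m n"])
    fix M z w assume M: "max N N' \<le> M" and zw: "(z, w) \<in> X"
    then show "h (z, w) = (\<Sum>m=-int M..int M. \<Sum>n=-int M..int M. (a m n + b m n) * z powi m * w powi n)"
      using add.hyps(3)[OF zw] a(1)[of M z w] b(1)[of M z w] by (simp add: sum.distrib distrib_right)
  next
    fix M assume "max N N' \<le> M"
    then show "F + G = (\<Sum>m=-int M..int M. \<Sum>n=-int M..int M. monomial_op (a m n + b m n) m n)"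
      using a(2)[of M] b(2)[of M] by (simp add: * sum.distrib)
  qed
qed

definition signed_op :: "bool \<Rightarrow> ('a \<Rightarrow>\<^sub>L 'a) \<Rightarrow> ('a \<Rightarrow>\<^sub>L 'a)"
  where "signed_op s T = (if s then T else op_inverse T)"

definition signed_index :: "bool \<Rightarrow> int \<Rightarrow> int"
  where "signed_index s n = (if s then n else - n)"

lemma op_powi_signed_index: "op_powi T (signed_index s (int i)) x = (blinfun_apply (signed_op s T) ^^ i) x"
  by (cases "i = 0") (auto simp: op_powi_def signed_index_def signed_op_def op_power_apply)

lemma boundary_circle:
  assumes "cmod z = r \<or> cmod z = 1 / r"
  shows "z \<in> closed_annulus r" "inverse z \<in> closed_annulus r"
proof -
  have "1 / r \<le> r"
    using r by (intro order_trans[of "1 / r" 1 r]) auto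
  moreover have "cmod (inverse z) = 1 / cmod z"
    by (simp add: norm_inverse divide_inverse)
  ultimately show "z \<in> closed_annulus r" "inverse z \<in> closed_annulus r"
    using assms by (auto simp: closed_annulus_def)
qed

text \<open>
  The four sign patterns give four pairs of commuting operators of norm at most \<open>r\<close>, to each of which
  Ando's inequality applies. Substituting \<open>1/z\<close> for \<open>z\<close> permutes the four parts and preserves the biannulus,
  so one estimate of the analytic part serves all of them.
\<close>

theorem laurent_bound:
  assumes "laurent f F" and C: "\<And>x. x \<in> X \<Longrightarrow> cmod (f x) \<le> C"
  shows "norm F \<le> (2 + shields_const r)\<^sup>2 * C"
proof -
  obtain N a where aN: "\<And>M z w. M \<ge> N \<Longrightarrow> (z, w) \<in> X \<Longrightarrow>
       f (z, w) = (\<Sum>m=-int M..int M. \<Sum>n=-int M..int M. a m n * z powi m * w powi n)"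
    and FN: "\<And>M. M \<ge> N \<Longrightarrow> F = (\<Sum>m=-int M..int M. \<Sum>n=-int M..int M. monomial_op (a m n) m n)"
    by (rule laurent_normal_form[OF assms(1)]) blast
  note a = aN[OF order_refl] and F = FN[OF order_refl]
  have C0: "C \<ge> 0"
  proof -
    have "(1, 1) \<in> X" using r by (simp add: closed_annulus_def)
    then show ?thesis using C norm_ge_zero order_trans by blast
  qed
  define K where "K = (1 + shields_const r / 2)\<^sup>2 * C"
  define d where "d h k m n = a m n * cinner (op_powi T1 m (op_powi T2 n h)) k" for h k m n
  define q where "q s t h k = (\<Sum>i\<le>N. \<Sum>j\<le>N. of_real (half_at_zero i * half_at_zero j) * d h k (signed_index s (int i)) (signed_index t (int j)))" for s t h k
  have quarter: "2 * cmod (q s t h k) \<le> K * ((norm h)\<^sup>2 + (norm k)\<^sup>2)" for s t h k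
  proof -
    define c where "c i j = of_real (half_at_zero i * half_at_zero j) * a (signed_index s (int i)) (signed_index t (int j))" for i j
    have "q s t h k = (\<Sum>i\<le>N. \<Sum>j\<le>N. c i j * cinner ((blinfun_apply (signed_op s T1) ^^ i) ((blinfun_apply (signed_op t T2) ^^ j) h)) k)"
      by (simp add: q_def c_def d_def op_powi_signed_index mult_ac)
    also have "2 * cmod \<dots> \<le> K * ((norm h)\<^sup>2 + (norm k)\<^sup>2)"
    proof (rule ando_inequality)
      show "clinear_op (signed_op s T1)" "clinear_op (signed_op t T2)"
        using lin1 lin2 inv1 inv2 by (auto simp: signed_op_def clinear_op_inverse)
      show "norm (signed_op s T1) \<le> r" "norm (signed_op t T2) \<le> r" "r > 0"
        using norm1 norm2 norm1' norm2' r by (auto simp: signed_op_def)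
      have "op_powi T1 (signed_index s 1) (op_powi T2 (signed_index t 1) x) = op_powi T2 (signed_index t 1) (op_powi T1 (signed_index s 1) x)" for x
        by (rule commute_powi)
      then show "signed_op s T1 o\<^sub>L signed_op t T2 = signed_op t T2 o\<^sub>L signed_op s T1"
        using op_powi_signed_index[where i = 1] by (intro blinfun_eqI) simp
      fix z w assume zw: "cmod z = r" "cmod w = r"
      define b where "b m n = a (signed_index s m) (signed_index t n)" for m n
      have "cmod (\<Sum>i\<le>N. \<Sum>j\<le>N. of_real (half_at_zero i * half_at_zero j) * b (int i) (int j) * z ^ i * w ^ j)
        \<le> (1 + shields_const r / 2)\<^sup>2 * C"
      proof (rule analytic_part_bound_two_variables[OF r _ zw])
        fix z w assume z: "cmod z = r \<or> cmod z = 1 / r" and w: "cmod w = r \<or> cmod w = 1 / r"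
        define z' w' where "z' = (if s then z else inverse z)" and "w' = (if t then w else inverse w)"
        have zw': "(z', w') \<in> X"
          using boundary_circle[OF z] boundary_circle[OF w] by (simp add: z'_def w'_def)
        (* Reversing the sign of the summation index, to match the substitution of 1/z for z. *)
        have flip: "(\<Sum>m=-int N..int N. g (signed_index s m)) = (\<Sum>m=-int N..int N. g m)" for s and g :: "int \<Rightarrow> complex"
          by (cases s) (auto simp: signed_index_def intro!: sum.reindex_bij_witness[of _ uminus uminus])
        have "f (z', w') = (\<Sum>m=-int N..int N. \<Sum>n=-int N..int N. a m n * z' powi m * w' powi n)"
          by (rule a[OF zw'])
        also have "\<dots> = (\<Sum>m=-int N..int N. \<Sum>n=-int N..int N. a (signed_index s m) n * z' powi (signed_index s m) * w' powi n)"
          by (rule flip[symmetric])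
        also have "\<dots> = (\<Sum>m=-int N..int N. \<Sum>n=-int N..int N. a (signed_index s m) (signed_index t n) * z' powi (signed_index s m) * w' powi (signed_index t n))"
          by (rule sum.cong[OF refl], rule flip[symmetric])
        also have "\<dots> = (\<Sum>m=-int N..int N. \<Sum>n=-int N..int N. b m n * z powi m * w powi n)"
          by (simp add: b_def z'_def w'_def signed_index_def power_int_minus power_int_inverse)
        finally show "cmod (\<Sum>m=-int N..int N. \<Sum>n=-int N..int N. b m n * z powi m * w powi n) \<le> C"
          using C[OF zw'] by simp
      qed
      then show "cmod (\<Sum>i\<le>N. \<Sum>j\<le>N. c i j * z ^ i * w ^ j) \<le> K"
        by (simp add: c_def b_def K_def)
    qed
    finally show ?thesis .
  qed
  have split: "cinner (F h) k = q True True h k + q True False h k + (q False True h k + q False False h k)" for h k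
  proof -
    have "cinner (F h) k = (\<Sum>m=-int N..int N. \<Sum>n=-int N..int N. d h k m n)"
      by (simp add: F d_def blinfun.sum_left cinner_sum_left monomial_op_apply cinner_scaleC_left)
    also have "\<dots> = (\<Sum>m=-int N..int N. (\<Sum>j\<le>N. half_at_zero j *\<^sub>R d h k m (int j)) + (\<Sum>j\<le>N. half_at_zero j *\<^sub>R d h k m (- int j)))"
      by (simp only: sum_symmetric_split[of "d h k m" for m])
    also have "\<dots> = q True True h k + q True False h k + (q False True h k + q False False h k)"
      unfolding sum_symmetric_split q_def signed_index_def
      by (simp add: scaleR_conv_of_real distrib_left sum.distrib sum_distrib_left mult.assoc)
    finally show ?thesis .
  qed
  have "norm F \<le> 4 * K"
  proof (rule norm_le_of_cinner_bound)
    show "4 * K \<ge> 0" using C0 by (simp add: K_def)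
    fix h k
    have "cmod (cinner (F h) k) \<le> cmod (q True True h k) + cmod (q True False h k) + (cmod (q False True h k) + cmod (q False False h k))"
      unfolding split by (intro order_trans[OF norm_triangle_ineq] add_mono norm_triangle_ineq order_refl)
    then show "2 * cmod (cinner (F h) k) \<le> 4 * K * ((norm h)\<^sup>2 + (norm k)\<^sup>2)"
      using quarter[of True True h k] quarter[of True False h k] quarter[of False True h k] quarter[of False False h k]
      by linarith
  qed
  also have "4 * K = (2 + shields_const r)\<^sup>2 * C"
    by (simp add: K_def power2_eq_square algebra_simps)
  finally show ?thesis .
qed

end

section \<open>Analysis on the closed annulus\<close>

text \<open>
  Uniform continuity on the compact product makes the same mesh good enough for all parameters.
\<close>

lemma riemann_sum_uniform:
  fixes F :: "real \<Rightarrow> 'b :: metric_space \<Rightarrow> complex"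
  assumes K: "compact K" and cont: "continuous_on ({0..1} \<times> K) (\<lambda>y. F (fst y) (snd y))" and e: "e > 0"
  shows "\<exists>N>0. \<forall>x\<in>K. cmod (integral {0..1} (\<lambda>t. F t x) - (\<Sum>k<N. F (real k / real N) x / of_nat N)) \<le> e"
proof -
  have "uniformly_continuous_on ({0..1} \<times> K) (\<lambda>y. F (fst y) (snd y))"
    by (intro compact_uniformly_continuous cont compact_Times K) simp
  then obtain d where d: "d > 0" and
    dF: "\<And>y y'. y \<in> {0..1} \<times> K \<Longrightarrow> y' \<in> {0..1} \<times> K \<Longrightarrow> dist y' y < d \<Longrightarrow> dist (F (fst y') (snd y')) (F (fst y) (snd y)) < e"
    using e unfolding uniformly_continuous_on_def by metis
  obtain N :: nat where N: "N > 0" "1 / real N < d"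
    using d by (metis nat_approx_posE of_nat_Suc zero_less_Suc)
  have "cmod (integral {0..1} (\<lambda>t. F t x) - (\<Sum>k<N. F (real k / real N) x / of_nat N)) \<le> e" if x: "x \<in> K" for x
  proof -
    define f where "f t = F t x" for t
    have contf: "continuous_on {0..1} f"
    proof -
      have "continuous_on {0..1} ((\<lambda>y. F (fst y) (snd y)) \<circ> (\<lambda>t. (t, x)))"
        by (intro continuous_on_compose continuous_on_subset[OF cont] continuous_intros) (use x in auto)
      then show ?thesis by (simp add: f_def o_def)
    qed
    define p where "p n = real n / real N" for n
    have "n \<le> N \<Longrightarrow> cmod (integral {0..p n} f - (\<Sum>k<n. f (p k) / of_nat N)) \<le> n * (e / N)" for n
    proof (induction n)
      case 0
      then show ?case by (simp add: p_def)
    next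
      case (Suc n)
      have p: "0 \<le> p n" "p n \<le> p (Suc n)" "p (Suc n) \<le> 1" "p (Suc n) - p n = 1 / N"
        using Suc.prems N by (auto simp: p_def divide_right_mono simp flip: diff_divide_distrib)
      have c: "continuous_on {a..b} f" if "0 \<le> a" "b \<le> 1" for a b
        by (rule continuous_on_subset[OF contf]) (use that in auto)
      have comb: "integral {0..p (Suc n)} f = integral {0..p n} f + integral {p n..p (Suc n)} f"
        by (rule Henstock_Kurzweil_Integration.integral_combine[symmetric]) (use p in \<open>auto intro!: integrable_continuous_real c\<close>)
      have "integral {p n..p (Suc n)} (\<lambda>t. f t - f (p n)) = integral {p n..p (Suc n)} f - integral {p n..p (Suc n)} (\<lambda>t. f (p n))"
        by (rule integral_diff) (use p in \<open>auto intro!: integrable_continuous_real c\<close>)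
      also have "integral {p n..p (Suc n)} (\<lambda>t. f (p n)) = f (p n) / of_nat N"
        using p by (simp add: scaleR_conv_of_real)
      finally have diff: "integral {p n..p (Suc n)} f - f (p n) / of_nat N = integral {p n..p (Suc n)} (\<lambda>t. f t - f (p n))" ..
      have "cmod (integral {p n..p (Suc n)} (\<lambda>t. f t - f (p n))) \<le> e * (p (Suc n) - p n)"
      proof (rule integral_bound[OF p(2)])
        show "continuous_on {p n..p (Suc n)} (\<lambda>t. f t - f (p n))"
          using p by (intro continuous_intros c) auto
        fix t assume t: "t \<in> {p n..p (Suc n)}"
        have "dist (t, x) (p n, x) = \<bar>t - p n\<bar>"
          by (simp add: dist_Pair_Pair dist_real_def)
        also have "\<dots> \<le> 1 / N" using t p by auto
        finally have "dist (t, x) (p n, x) < d" using N by simp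
        then show "cmod (f t - f (p n)) \<le> e"
          using dF[of "(p n, x)" "(t, x)"] t p x by (auto simp: f_def dist_norm intro: less_imp_le)
      qed
      then have step: "cmod (integral {p n..p (Suc n)} f - f (p n) / of_nat N) \<le> e / N"
        unfolding diff p(4) by simp
      have "integral {0..p (Suc n)} f - (\<Sum>k<Suc n. f (p k) / of_nat N)
        = (integral {0..p n} f - (\<Sum>k<n. f (p k) / of_nat N)) + (integral {p n..p (Suc n)} f - f (p n) / of_nat N)"
        unfolding comb by simp
      also have "cmod \<dots> \<le> n * (e / N) + e / N"
        using Suc by (intro order_trans[OF norm_triangle_ineq] add_mono step) auto
      also have "\<dots> = Suc n * (e / N)"
        by (simp add: distrib_right add_divide_distrib)
      finally show ?case .
    qed
    from this[of N] show ?thesis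
      using N by (simp add: p_def f_def[abs_def])
  qed
  then show ?thesis using N by blast
qed

text \<open>
  The difference quotient of \<open>f\<close> at \<open>z\<close> extends holomorphically over \<open>z\<close>, so its integrals over the two
  homotopic circles agree. The integral of \<open>1 / (\<zeta> - z)\<close> is \<open>2 \<pi> i\<close> over the outer and \<open>0\<close> over the
  inner circle.
\<close>

lemma Cauchy_formula_annulus:
  assumes f: "f holomorphic_on {\<zeta>. a < cmod \<zeta> \<and> cmod \<zeta> < b}"
    and \<rho>: "a < \<rho>1" "0 < \<rho>1" "\<rho>1 < cmod z" "cmod z < \<rho>2" "\<rho>2 < b"
  shows "contour_integral (circlepath 0 \<rho>2) (\<lambda>\<zeta>. f \<zeta> / (\<zeta> - z))
    - contour_integral (circlepath 0 \<rho>1) (\<lambda>\<zeta>. f \<zeta> / (\<zeta> - z)) = 2 * pi * \<i> * f z"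
proof -
  define S where "S = {\<zeta>. a < cmod \<zeta> \<and> cmod \<zeta> < b}"
  have S: "open S"
    unfolding S_def by (intro open_Collect_conj open_Collect_less continuous_intros)
  (* The difference quotient, with its removable singularity at z filled in. *)
  define h where "h = (\<lambda>\<zeta>. if \<zeta> = z then deriv f z else (f \<zeta> - f z) / (\<zeta> - z))"
  have h: "h holomorphic_on S"
    unfolding h_def by (rule pole_lemma_open[OF _ S]) (use f in \<open>simp add: S_def\<close>)
  have hom: "homotopic_loops S (circlepath 0 \<rho>2) (circlepath 0 \<rho>1)"
  proof (rule homotopic_loops_linear)
    fix t :: real
    define v where "v = exp (2 * of_real pi * \<i> * of_real t)"
    have v: "cmod v = 1" by (simp add: v_def)
    have c: "circlepath 0 \<rho> t = of_real \<rho> * v" for \<rho>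
      by (simp add: circlepath v_def)
    show "closed_segment (circlepath 0 \<rho>2 t) (circlepath 0 \<rho>1 t) \<subseteq> S"
    proof
      fix y assume "y \<in> closed_segment (circlepath 0 \<rho>2 t) (circlepath 0 \<rho>1 t)"
      then obtain u where u: "0 \<le> u" "u \<le> 1" "y = (1 - u) *\<^sub>R (of_real \<rho>2 * v) + u *\<^sub>R (of_real \<rho>1 * v)"
        by (auto simp: in_segment c)
      define s where "s = (1 - u) * \<rho>2 + u * \<rho>1"
      have "y = of_real s * v"
        using u(3) by (simp add: s_def scaleR_conv_of_real algebra_simps)
      moreover have s: "\<rho>1 \<le> s" "s \<le> \<rho>2"
      proof -
        have "s = \<rho>1 + (1 - u) * (\<rho>2 - \<rho>1)" "s = \<rho>2 - u * (\<rho>2 - \<rho>1)"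
          by (simp_all add: s_def algebra_simps)
        moreover have "(1 - u) * (\<rho>2 - \<rho>1) \<ge> 0" "u * (\<rho>2 - \<rho>1) \<ge> 0"
          using u \<rho> by auto
        ultimately show "\<rho>1 \<le> s" "s \<le> \<rho>2" by linarith+
      qed
      ultimately show "y \<in> S"
        using \<rho> v by (simp add: S_def norm_mult)
    qed
  qed (auto simp: S_def)
  have eq: "contour_integral (circlepath 0 \<rho>2) h = contour_integral (circlepath 0 \<rho>1) h"
    by (rule Cauchy_theorem_homotopic_loops[OF hom S h]) auto
  have split: "contour_integral (circlepath 0 \<rho>) h = contour_integral (circlepath 0 \<rho>) (\<lambda>\<zeta>. f \<zeta> / (\<zeta> - z))
      - f z * contour_integral (circlepath 0 \<rho>) (\<lambda>\<zeta>. 1 / (\<zeta> - z))"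
    if "\<rho> = \<rho>1 \<or> \<rho> = \<rho>2" for \<rho>
  proof -
    have pos: "\<rho> > 0" "\<rho> \<noteq> cmod z" "a < \<rho>" "\<rho> < b" using that \<rho> by auto
    have im: "path_image (circlepath 0 \<rho>) = sphere 0 \<rho>"
      using pos by simp
    have nz: "\<zeta> - z \<noteq> 0" if "\<zeta> \<in> sphere 0 \<rho>" for \<zeta>
      using that pos by auto
    have cf: "continuous_on (sphere 0 \<rho>) f"
      by (rule continuous_on_subset[OF holomorphic_on_imp_continuous_on[OF f]]) (use pos in auto)
    have i1: "(\<lambda>\<zeta>. f \<zeta> / (\<zeta> - z)) contour_integrable_on circlepath 0 \<rho>"
      by (rule contour_integrable_continuous_circlepath, unfold im)
        (intro continuous_intros cf ballI nz)
    have i2: "(\<lambda>\<zeta>. 1 / (\<zeta> - z)) contour_integrable_on circlepath 0 \<rho>"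
      by (rule contour_integrable_continuous_circlepath, unfold im) (intro continuous_intros ballI nz)
    have "contour_integral (circlepath 0 \<rho>) h = contour_integral (circlepath 0 \<rho>) (\<lambda>\<zeta>. f \<zeta> / (\<zeta> - z) - f z * (1 / (\<zeta> - z)))"
      by (rule contour_integral_cong) (use nz im pos in \<open>auto simp: h_def diff_divide_distrib\<close>)
    also have "\<dots> = contour_integral (circlepath 0 \<rho>) (\<lambda>\<zeta>. f \<zeta> / (\<zeta> - z))
      - contour_integral (circlepath 0 \<rho>) (\<lambda>\<zeta>. f z * (1 / (\<zeta> - z)))"
      by (intro contour_integral_diff i1 contour_integrable_lmul i2)
    also have "contour_integral (circlepath 0 \<rho>) (\<lambda>\<zeta>. f z * (1 / (\<zeta> - z))) = f z * contour_integral (circlepath 0 \<rho>) (\<lambda>\<zeta>. 1 / (\<zeta> - z))"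
      by (rule contour_integral_lmul[OF i2])
    finally show ?thesis .
  qed
  have outer: "contour_integral (circlepath 0 \<rho>2) (\<lambda>\<zeta>. 1 / (\<zeta> - z)) = 2 * pi * \<i>"
    using Cauchy_integral_circlepath_simple[of "\<lambda>_. 1" 0 \<rho>2 z] \<rho> by (auto intro: contour_integral_unique)
  have inner: "contour_integral (circlepath 0 \<rho>1) (\<lambda>\<zeta>. 1 / (\<zeta> - z)) = 0"
  proof (rule contour_integral_unique, rule Cauchy_theorem_convex_simple)
    show "(\<lambda>\<zeta>. 1 / (\<zeta> - z)) holomorphic_on ball 0 (cmod z)"
      by (intro holomorphic_intros) auto
    show "path_image (circlepath 0 \<rho>1) \<subseteq> ball 0 (cmod z)"
      using \<rho> by auto
  qed auto
  show ?thesis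
    using eq unfolding split[of \<rho>1, simplified] split[of \<rho>2, simplified] outer inner by (simp add: algebra_simps)
qed

lemma contour_integral_circlepath_0:
  "contour_integral (circlepath 0 \<rho>) f = integral {0..1} (\<lambda>t. f (of_real \<rho> * exp (2 * of_real pi * \<i> * of_real t))
     * (2 * pi * \<i> * \<rho> * exp (2 * of_real pi * \<i> * of_real t)))"
  unfolding contour_integral_integral vector_derivative_circlepath unfolding circlepath by simp

lemma continuous_on_eval2 [continuous_intros]:
  assumes "continuous_on S f" "continuous_on S g"
  shows "continuous_on S (\<lambda>x. eval2 q (f x, g x))"
  unfolding eval2_eq_sum by (intro continuous_intros assms)

lemma holomorphic_on_eval2: "(\<lambda>z. eval2 q (z, w)) holomorphic_on S"
  unfolding eval2_eq_sum by (intro holomorphic_intros)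

lemma compact_closed_annulus: "compact (closed_annulus \<rho>)"
proof -
  have "closed_annulus \<rho> = cball 0 \<rho> \<inter> {z. 1 / \<rho> \<le> cmod z}"
    by (auto simp: closed_annulus_def)
  moreover have "closed {z. 1 / \<rho> \<le> cmod z}"
    by (intro closed_Collect_le continuous_intros)
  ultimately show ?thesis
    by (metis compact_Int_closed compact_cball)
qed

text \<open>
  Otherwise zeros over annuli shrinking to the given one would accumulate at a zero over it. Only the first variable
  needs room, since Cauchy's formula is applied in that variable alone.
\<close>

lemma zero_free_enlarge:
  assumes r: "r > 1"
    and q: "\<And>z w. z \<in> closed_annulus r \<Longrightarrow> w \<in> closed_annulus r \<Longrightarrow> eval2 q (z, w) \<noteq> 0"
  obtains \<rho> where "\<rho> > r" "\<And>z w. z \<in> closed_annulus \<rho> \<Longrightarrow> w \<in> closed_annulus r \<Longrightarrow> eval2 q (z, w) \<noteq> 0"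
proof (rule ccontr)
  assume neg: "\<not> thesis"
  define R where "R n = r + 1 / real (Suc n)" for n
  have R: "R n > r" "R n \<le> r + 1" for n
    by (auto simp: R_def)
  have "\<exists>z w. z \<in> closed_annulus (R n) \<and> w \<in> closed_annulus r \<and> eval2 q (z, w) = 0" for n
    using neg that[OF R(1)] by blast
  then obtain z w where zw: "\<And>n. z n \<in> closed_annulus (R n)" "\<And>n. w n \<in> closed_annulus r" "\<And>n. eval2 q (z n, w n) = 0"
    by metis
  have "closed_annulus (R n) \<subseteq> closed_annulus (r + 1)" for n
  proof -
    have "1 / (r + 1) \<le> 1 / R n"
      using R[of n] r by (intro divide_left_mono) auto
    then show ?thesis
      using R[of n] by (auto simp: closed_annulus_def)
  qed
  then have mem: "\<forall>n. (z n, w n) \<in> closed_annulus (r + 1) \<times> closed_annulus r"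
    using zw by blast
  have compact: "seq_compact (closed_annulus (r + 1) \<times> closed_annulus r)"
    by (intro compact_imp_seq_compact compact_Times compact_closed_annulus)
  obtain l s where l: "l \<in> closed_annulus (r + 1) \<times> closed_annulus r"
    and s: "strict_mono (s :: nat \<Rightarrow> nat)" and lim: "((\<lambda>n. (z n, w n)) \<circ> s) \<longlonglongrightarrow> l"
    by (rule seq_compactE[OF compact mem])
  obtain z0 w0 where l0: "l = (z0, w0)" by force
  have z0: "(\<lambda>n. z (s n)) \<longlonglongrightarrow> z0" and w0: "(\<lambda>n. w (s n)) \<longlonglongrightarrow> w0"
    using tendsto_fst[OF lim] tendsto_snd[OF lim] by (auto simp: l0 o_def)
  have Rlim: "(\<lambda>n. R (s n)) \<longlonglongrightarrow> r"
  proof -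
    have "R \<longlonglongrightarrow> r + 0"
      unfolding R_def by (intro tendsto_intros LIMSEQ_Suc[OF lim_1_over_n])
    then show ?thesis
      using LIMSEQ_subseq_LIMSEQ[OF _ s, of R r] by (simp add: o_def)
  qed
  have "(\<lambda>n. 1 / R (s n)) \<longlonglongrightarrow> 1 / r"
    using r by (intro tendsto_intros Rlim) auto
  then have "1 / r \<le> cmod z0"
    by (rule LIMSEQ_le[OF _ tendsto_norm[OF z0]]) (use zw in \<open>auto simp: closed_annulus_def\<close>)
  moreover have "cmod z0 \<le> r"
    by (rule LIMSEQ_le[OF tendsto_norm[OF z0] Rlim]) (use zw in \<open>auto simp: closed_annulus_def\<close>)
  ultimately have "eval2 q (z0, w0) \<noteq> 0"
    using l by (intro q) (auto simp: l0 closed_annulus_def)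
  moreover have "eval2 q (z0, w0) = 0"
  proof -
    have "(\<lambda>n. eval2 q (z (s n), w (s n))) \<longlonglongrightarrow> eval2 q (z0, w0)"
      unfolding eval2_eq_sum by (intro tendsto_intros z0 w0)
    then show ?thesis
      using zw(3) LIMSEQ_unique[OF tendsto_const] by fastforce
  qed
  ultimately show False by simp
qed

text \<open>
  A boundary point \<open>z\<close> is the limit of \<open>z |z|\<^sup>t\<close> as \<open>t\<close> increases to \<open>0\<close>: the modulus of such a point is
  \<open>|z|\<close> to the power \<open>1 + t < 1\<close>, which moves it towards the unit circle.
\<close>

lemma closure_annulus:
  assumes r: "r > 1"
  shows "closure (annulus r) = closed_annulus r"
proof
  have "annulus r \<subseteq> closed_annulus r"
    by (auto simp: annulus_def closed_annulus_def inverse_eq_divide)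
  then show "closure (annulus r) \<subseteq> closed_annulus r"
    by (intro closure_minimal compact_imp_closed compact_closed_annulus)
  show "closed_annulus r \<subseteq> closure (annulus r)"
  proof
    fix z assume z: "z \<in> closed_annulus r"
    have z0: "cmod z > 0"
      using z r by (auto simp: closed_annulus_def intro: less_le_trans[of 0 "1 / r"])
    define t where "t n = - (1 / real (Suc n))" for n
    define x where "x n = z * of_real (cmod z powr t n)" for n
    have "(\<lambda>n. - (1 / real (Suc n))) \<longlonglongrightarrow> - 0"
      by (intro tendsto_minus LIMSEQ_Suc[OF lim_1_over_n])
    then have "t \<longlonglongrightarrow> 0"
      by (simp add: t_def[abs_def])
    then have "x \<longlonglongrightarrow> z * of_real (cmod z powr 0)"
      unfolding x_def using z0 by (intro tendsto_intros) auto
    then have "x \<longlonglongrightarrow> z" using z0 by simp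
    moreover have "x n \<in> annulus r" for n
    proof -
      define c where "c = 1 + t n"
      have c: "0 \<le> c" "c < 1" by (auto simp: c_def t_def)
      have L: "ln (cmod z) \<le> ln r" "- ln r \<le> ln (cmod z)" "0 < ln r"
        using z z0 r ln_mono[of "1 / r" "cmod z"] by (auto simp: closed_annulus_def ln_div)
      have "cmod (x n) = cmod z powr c"
        using z0 by (simp add: x_def norm_mult c_def powr_add)
      then have lnx: "ln (cmod (x n)) = c * ln (cmod z)" and pos: "cmod (x n) > 0"
        using z0 by (auto simp: ln_powr)
      have "c * ln (cmod z) \<le> c * ln r" "c * (- ln r) \<le> c * ln (cmod z)"
        by (intro mult_left_mono c L)+
      moreover have "c * ln r < ln r"
        using c L by simp
      moreover have "ln (1 / r) = - ln r"
        using r by (simp add: ln_div)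
      ultimately have "ln (cmod (x n)) < ln r" "ln (1 / r) < ln (cmod (x n))"
        unfolding lnx by linarith+
      then show ?thesis
        using pos r by (simp add: annulus_def inverse_eq_divide)
    qed
    ultimately show "z \<in> closure (annulus r)"
      by (meson closure_sequential)
  qed
qed

section \<open>Approximation by Laurent polynomials and the theorem\<close>

context annulus_pair
begin

text \<open>
  The uniform closure of the Laurent polynomials on the closed biannulus; it is an algebra and closed under uniform
  limits.
\<close>

definition approximable :: "(complex \<times> complex \<Rightarrow> complex) \<Rightarrow> bool"
  where "approximable f \<longleftrightarrow> (\<forall>e>0. \<exists>g G. laurent g G \<and> (\<forall>x\<in>X. cmod (f x - g x) \<le> e))"

lemma approximableE:
  assumes "approximable f" "e > 0"
  obtains g G where "laurent g G" "\<And>x. x \<in> X \<Longrightarrow> cmod (f x - g x) \<le> e"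
  using assms unfolding approximable_def by blast

lemma norm_powi_le:
  assumes "z \<in> closed_annulus r"
  shows "cmod (z powi m) \<le> r ^ nat \<bar>m\<bar>"
proof (cases "m \<ge> 0")
  case True
  then show ?thesis
    using assms by (auto simp: closed_annulus_def power_int_def norm_power intro!: power_mono)
next
  case False
  have z0: "cmod z > 0"
    using closed_annulus_nonzero[OF assms] by simp
  have "1 / cmod z \<le> r"
    using assms z0 r by (simp add: closed_annulus_def field_simps)
  then have "(1 / cmod z) ^ nat (- m) \<le> r ^ nat (- m)"
    using z0 by (intro power_mono) auto
  then show ?thesis
    using False by (simp add: power_int_def norm_power norm_inverse inverse_eq_divide norm_divide)
qed

lemma laurent_bounded: "laurent g G \<Longrightarrow> \<exists>K. \<forall>x\<in>X. cmod (g x) \<le> K"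
proof (induction rule: laurent.induct)
  case (monomial f c m n)
  have "cmod (f (z, w)) \<le> cmod c * r ^ nat \<bar>m\<bar> * r ^ nat \<bar>n\<bar>" if "(z, w) \<in> X" for z w
    unfolding monomial[OF that] norm_mult using that r
    by (intro mult_mono norm_powi_le) auto
  then show ?case by fast
next
  case (add f F g G h)
  then obtain K K' where "\<forall>x\<in>X. cmod (f x) \<le> K" "\<forall>x\<in>X. cmod (g x) \<le> K'" by blast
  then have "\<forall>x\<in>X. cmod (h x) \<le> K + K'"
    using add.hyps(3) by (auto intro!: order_trans[OF norm_triangle_ineq] add_mono)
  then show ?case ..
qed

lemma approximable_laurent: "laurent g G \<Longrightarrow> approximable g"
  unfolding approximable_def by (intro allI impI exI[of _ g] exI[of _ G]) auto

lemma approximable_const: "approximable (\<lambda>x. c)"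
  by (rule approximable_laurent, rule laurent.monomial[of _ c 0 0]) simp

lemma approximable_coordinates:
  "approximable fst" "approximable snd" "approximable (\<lambda>x. 1 / fst x)" "approximable (\<lambda>x. 1 / snd x)"
proof -
  show "approximable fst"
    by (rule approximable_laurent, rule laurent.monomial[of _ 1 1 0]) simp
  show "approximable snd"
    by (rule approximable_laurent, rule laurent.monomial[of _ 1 0 1]) simp
  show "approximable (\<lambda>x. 1 / fst x)"
    by (rule approximable_laurent, rule laurent.monomial[of _ 1 "-1" 0]) (simp add: power_int_minus divide_inverse)
  show "approximable (\<lambda>x. 1 / snd x)"
    by (rule approximable_laurent, rule laurent.monomial[of _ 1 0 "-1"]) (simp add: power_int_minus divide_inverse)
qed

lemma approximable_bounded:
  assumes "approximable f"
  obtains K where "K > 0" "\<And>x. x \<in> X \<Longrightarrow> cmod (f x) \<le> K"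
proof -
  obtain g G where g: "laurent g G" "\<And>x. x \<in> X \<Longrightarrow> cmod (f x - g x) \<le> 1"
    using assms approximableE zero_less_one by blast
  obtain K where K: "\<And>x. x \<in> X \<Longrightarrow> cmod (g x) \<le> K"
    using laurent_bounded[OF g(1)] by blast
  show ?thesis
  proof (rule that[of "\<bar>K\<bar> + 1"])
    fix x assume x: "x \<in> X"
    have "cmod (f x) \<le> cmod (f x - g x) + cmod (g x)"
      by (metis diff_add_cancel norm_triangle_ineq)
    then show "cmod (f x) \<le> \<bar>K\<bar> + 1"
      using g(2)[OF x] K[OF x] by linarith
  qed simp
qed

lemma approximable_limit:
  assumes "\<And>e. e > 0 \<Longrightarrow> \<exists>g. approximable g \<and> (\<forall>x\<in>X. cmod (f x - g x) \<le> e)"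
  shows "approximable f"
  unfolding approximable_def
proof (intro allI impI)
  fix e :: real assume "e > 0"
  then obtain g where g: "approximable g" "\<And>x. x \<in> X \<Longrightarrow> cmod (f x - g x) \<le> e / 2"
    using assms[of "e / 2"] by auto
  obtain h H where h: "laurent h H" "\<And>x. x \<in> X \<Longrightarrow> cmod (g x - h x) \<le> e / 2"
    using approximableE[OF g(1), of "e / 2"] \<open>e > 0\<close> by auto
  have "cmod (f x - h x) \<le> e" if "x \<in> X" for x
    using norm_triangle_ineq[of "f x - g x" "g x - h x"] g(2)[OF that] h(2)[OF that] by simp
  then show "\<exists>g G. laurent g G \<and> (\<forall>x\<in>X. cmod (f x - g x) \<le> e)"
    using h(1) by blast
qed

lemma approximable_cong: "approximable g \<Longrightarrow> (\<And>x. x \<in> X \<Longrightarrow> f x = g x) \<Longrightarrow> approximable f"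
  unfolding approximable_def by simp

lemma approximable_add:
  assumes "approximable f" "approximable g"
  shows "approximable (\<lambda>x. f x + g x)"
  unfolding approximable_def
proof (intro allI impI)
  fix e :: real assume "e > 0"
  then have e: "e / 2 > 0" by simp
  obtain f' F where f: "laurent f' F" "\<And>x. x \<in> X \<Longrightarrow> cmod (f x - f' x) \<le> e / 2"
    using approximableE[OF assms(1) e] by blast
  obtain g' G where g: "laurent g' G" "\<And>x. x \<in> X \<Longrightarrow> cmod (g x - g' x) \<le> e / 2"
    using approximableE[OF assms(2) e] by blast
  have "cmod (f x + g x - (f' x + g' x)) \<le> e" if "x \<in> X" for x
    using norm_diff_triangle_ineq[of "f x" "g x" "f' x" "g' x"] f(2)[OF that] g(2)[OF that] by simp
  then show "\<exists>h H. laurent h H \<and> (\<forall>x\<in>X. cmod (f x + g x - h x) \<le> e)"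
    using laurent.add[OF f(1) g(1), of "\<lambda>x. f' x + g' x"] by blast
qed

lemma approximable_mult:
  assumes "approximable f" "approximable g"
  shows "approximable (\<lambda>x. f x * g x)"
  unfolding approximable_def
proof (intro allI impI)
  fix e :: real assume "e > 0"
  obtain A where A: "A > 0" "\<And>x. x \<in> X \<Longrightarrow> cmod (f x) \<le> A"
    using approximable_bounded[OF assms(1)] by blast
  have "e / (2 * A) > 0" using A \<open>e > 0\<close> by simp
  then obtain g' G where g: "laurent g' G" "\<And>x. x \<in> X \<Longrightarrow> cmod (g x - g' x) \<le> e / (2 * A)"
    using approximableE[OF assms(2)] by blast
  obtain B where B: "B > 0" "\<And>x. x \<in> X \<Longrightarrow> cmod (g' x) \<le> B"
    using approximable_bounded[OF approximable_laurent[OF g(1)]] by blast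
  have "e / (2 * B) > 0" using B \<open>e > 0\<close> by simp
  then obtain f' F where f: "laurent f' F" "\<And>x. x \<in> X \<Longrightarrow> cmod (f x - f' x) \<le> e / (2 * B)"
    using approximableE[OF assms(1)] by blast
  have "cmod (f x * g x - f' x * g' x) \<le> e" if x: "x \<in> X" for x
  proof -
    have "f x * g x - f' x * g' x = f x * (g x - g' x) + (f x - f' x) * g' x"
      by (simp add: algebra_simps)
    also have "cmod \<dots> \<le> cmod (f x) * cmod (g x - g' x) + cmod (f x - f' x) * cmod (g' x)"
      by (rule order_trans[OF norm_triangle_ineq]) (simp add: norm_mult)
    also have "\<dots> \<le> A * (e / (2 * A)) + (e / (2 * B)) * B"
      using A B f(2)[OF x] g(2)[OF x] x \<open>e > 0\<close> by (intro add_mono mult_mono) auto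
    also have "\<dots> = e" using A B by simp
    finally show ?thesis .
  qed
  then show "\<exists>h H. laurent h H \<and> (\<forall>x\<in>X. cmod (f x * g x - h x) \<le> e)"
    using laurent_mult[OF f(1) g(1)] by blast
qed

lemma approximable_power: "approximable f \<Longrightarrow> approximable (\<lambda>x. f x ^ n)"
  by (induction n) (auto intro: approximable_const approximable_mult)

lemma approximable_sum: "(\<And>i. i \<in> I \<Longrightarrow> approximable (f i)) \<Longrightarrow> approximable (\<lambda>x. \<Sum>i\<in>I. f i x)"
  by (induction I rule: infinite_finite_induct) (auto intro: approximable_const approximable_add)

lemma approximable_geometric:
  assumes u: "approximable u" and q: "q < 1" "\<And>x. x \<in> X \<Longrightarrow> cmod (u x) \<le> q"
  shows "approximable (\<lambda>x. 1 / (1 - u x))"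
proof (rule approximable_limit)
  fix e :: real assume e: "e > 0"
  have "(1, 1) \<in> X"
    using r by (simp add: closed_annulus_def)
  then have q0: "q \<ge> 0"
    using q(2) norm_ge_zero order_trans by blast
  obtain n where n: "q ^ n < e * (1 - q)"
    using real_arch_pow_inv[of "e * (1 - q)" q] e q by auto
  have "cmod (1 / (1 - u x) - (\<Sum>i<n. u x ^ i)) \<le> e" if x: "x \<in> X" for x
  proof -
    have "cmod (u x) < 1" using q x by force
    then have u1: "u x \<noteq> 1" by auto
    have "(\<Sum>i<n. u x ^ i) = (1 - u x ^ n) / (1 - u x)"
      using u1 by (simp add: sum_gp_strict)
    then have "1 / (1 - u x) - (\<Sum>i<n. u x ^ i) = u x ^ n / (1 - u x)"
      by (simp add: diff_divide_distrib)
    moreover have "1 - q \<le> cmod (1 - u x)"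
      using norm_triangle_ineq2[of 1 "u x"] q(2)[OF x] by simp
    moreover have "cmod (u x) ^ n \<le> q ^ n"
      using q(2)[OF x] by (intro power_mono) auto
    ultimately have "cmod (1 / (1 - u x) - (\<Sum>i<n. u x ^ i)) \<le> q ^ n / (1 - q)"
      using q q0 by (simp add: norm_divide norm_power) (intro frac_le, auto)
    also have "\<dots> \<le> e"
      using n q by (simp add: field_simps)
    finally show ?thesis .
  qed
  then show "\<exists>g. approximable g \<and> (\<forall>x\<in>X. cmod (1 / (1 - u x) - g x) \<le> e)"
    using approximable_sum[of "{..<n}" "\<lambda>i x. u x ^ i"] approximable_power[OF u] by blast
qed

text \<open>
  A geometric series in \<open>p/a\<close> if \<open>a\<close> lies outside the annulus, in \<open>a/p\<close> if it lies in the hole. In the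
  application \<open>p\<close> is one of the two coordinates.
\<close>

lemma approximable_resolvent:
  assumes p: "approximable p" "approximable (\<lambda>x. 1 / p x)" "\<And>x. x \<in> X \<Longrightarrow> p x \<in> closed_annulus r"
    and a: "a \<notin> closed_annulus r"
  shows "approximable (\<lambda>x. 1 / (a - p x))"
proof (cases "cmod a > r")
  case True
  have a0: "a \<noteq> 0" using True r by auto
  have "approximable (\<lambda>x. 1 / (1 - (1 / a) * p x))"
  proof (rule approximable_geometric[where q = "r / cmod a"])
    show "r / cmod a < 1" using True r by (simp add: divide_less_eq)
    show "approximable (\<lambda>x. 1 / a * p x)"
      by (intro approximable_mult approximable_const p)
    fix x assume "x \<in> X"
    then show "cmod (1 / a * p x) \<le> r / cmod a"
      using p(3)[of x] a0 by (simp add: norm_mult norm_divide closed_annulus_def divide_right_mono)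
  qed
  then have "approximable (\<lambda>x. (1 / a) * (1 / (1 - (1 / a) * p x)))"
    by (intro approximable_mult approximable_const)
  then show ?thesis
  proof (rule approximable_cong)
    fix x
    have "a * (1 - (1 / a) * p x) = a - p x"
      using a0 by (simp add: algebra_simps)
    then show "1 / (a - p x) = (1 / a) * (1 / (1 - (1 / a) * p x))"
      by (metis divide_divide_eq_left' mult.commute mult.right_neutral times_divide_eq_left)
  qed
next
  case False
  then have a1: "cmod a < 1 / r"
    using a by (auto simp: closed_annulus_def)
  have p0: "p x \<noteq> 0" if "x \<in> X" for x
    using closed_annulus_nonzero p(3) that by blast
  have "approximable (\<lambda>x. 1 / (1 - a * (1 / p x)))"
  proof (rule approximable_geometric[where q = "cmod a * r"])
    show "cmod a * r < 1" using a1 r by (simp add: field_simps)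
    show "approximable (\<lambda>x. a * (1 / p x))"
      by (intro approximable_mult approximable_const p)
    fix x assume x: "x \<in> X"
    have "1 / cmod (p x) \<le> r"
      using p(3)[OF x] p0[OF x] r by (simp add: closed_annulus_def field_simps)
    then have "cmod a * (1 / cmod (p x)) \<le> cmod a * r"
      by (rule mult_left_mono) simp
    then show "cmod (a * (1 / p x)) \<le> cmod a * r"
      by (simp add: norm_mult norm_divide)
  qed
  then have "approximable (\<lambda>x. (- 1) * (1 / p x) * (1 / (1 - a * (1 / p x))))"
    by (intro approximable_mult approximable_const p)
  then show ?thesis
  proof (rule approximable_cong)
    fix x assume x: "x \<in> X"
    have "- (p x * (1 - a * (1 / p x))) = a - p x"
      using p0[OF x] by (simp add: algebra_simps)
    then have "1 / (a - p x) = 1 / (- (p x * (1 - a * (1 / p x))))"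
      by (simp only:)
    also have "\<dots> = (- 1) * (1 / p x) * (1 / (1 - a * (1 / p x)))"
      by simp
    finally show "1 / (a - p x) = (- 1) * (1 / p x) * (1 / (1 - a * (1 / p x)))" .
  qed
qed

lemma approximable_inverse_poly:
  assumes "\<And>w. w \<in> closed_annulus r \<Longrightarrow> poly Q w \<noteq> 0"
  shows "approximable (\<lambda>x. 1 / poly Q (snd x))"
  using assms
proof (induction "degree Q" arbitrary: Q)
  case 0
  then obtain c where "Q = [:c:]"
    by (metis degree_eq_zeroE)
  then show ?case
    by (simp add: approximable_const)
next
  case (Suc n)
  then have "\<not> constant (poly Q)"
    by (simp add: constant_degree)
  then obtain a where a: "poly Q a = 0"
    using fundamental_theorem_of_algebra by blast
  then obtain P where P: "Q = [:- a, 1:] * P"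
    using poly_eq_0_iff_dvd by (metis dvdE)
  have "P \<noteq> 0" using Suc.hyps(2) P by auto
  then have "degree ([:- a, 1:] * P) = degree [:- a, 1:] + degree P"
    by (intro degree_mult_eq) auto
  then have "n = degree P"
    using Suc.hyps(2) by (simp only: P) simp
  moreover have "poly P w \<noteq> 0" if "w \<in> closed_annulus r" for w
    using Suc.prems[OF that] by (simp add: P)
  ultimately have "approximable (\<lambda>x. 1 / poly P (snd x))"
    by (rule Suc.hyps(1))
  moreover have "approximable (\<lambda>x. 1 / (a - snd x))"
    by (rule approximable_resolvent) (use a Suc.prems approximable_coordinates in auto)
  ultimately have "approximable (\<lambda>x. (- 1) * (1 / (a - snd x)) * (1 / poly P (snd x)))"
    by (intro approximable_mult approximable_const)
  then show ?case
  proof (rule approximable_cong)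
    fix x :: "complex \<times> complex"
    have "poly Q (snd x) = - ((a - snd x) * poly P (snd x))"
      by (simp add: P algebra_simps)
    then show "1 / poly Q (snd x) = (- 1) * (1 / (a - snd x)) * (1 / poly P (snd x))"
      by (simp only: minus_divide_right[symmetric]) simp
  qed
qed

text \<open>
  For a fixed node \<open>\<zeta>\<close> the integrand is a product of a function of the first coordinate and a function of the second, and
  both have their poles off the annulus. Riemann sums preserve this.
\<close>

lemma approximable_cauchy_integral:
  assumes c: "\<rho> > 0" and out: "\<And>z. cmod z = \<rho> \<Longrightarrow> z \<notin> closed_annulus r"
    and q: "\<And>z w. cmod z = \<rho> \<Longrightarrow> w \<in> closed_annulus r \<Longrightarrow> eval2 q (z, w) \<noteq> 0"
  shows "approximable (\<lambda>x. contour_integral (circlepath 0 \<rho>) (\<lambda>\<zeta>. 1 / eval2 q (\<zeta>, snd x) / (\<zeta> - fst x)))"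
proof -
  define \<gamma> where "\<gamma> t = of_real \<rho> * exp (2 * of_real pi * \<i> * of_real t)" for t :: real
  define v where "v t = 2 * pi * \<i> * \<rho> * exp (2 * of_real pi * \<i> * of_real t)" for t :: real
  define F where "F t x = 1 / eval2 q (\<gamma> t, snd x) / (\<gamma> t - fst x) * v t" for t and x :: "complex \<times> complex"
  have \<gamma>: "cmod (\<gamma> t) = \<rho>" for t
    using c by (simp add: \<gamma>_def norm_mult)
  have int: "contour_integral (circlepath 0 \<rho>) (\<lambda>\<zeta>. 1 / eval2 q (\<zeta>, snd x) / (\<zeta> - fst x)) = integral {0..1} (\<lambda>t. F t x)" for x
    unfolding contour_integral_circlepath_0 F_def \<gamma>_def v_def ..
  have nz1: "eval2 q (\<gamma> t, w) \<noteq> 0" if "w \<in> closed_annulus r" for t w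
    using q \<gamma> that by blast
  have nz2: "\<gamma> t - z \<noteq> 0" if "z \<in> closed_annulus r" for t z
    using out[OF \<gamma>[of t]] that by auto
  have "continuous_on ({0..1} \<times> X) (\<lambda>y. F (fst y) (snd y))"
    unfolding F_def \<gamma>_def v_def
    by (intro continuous_intros) (use nz1 nz2 in \<open>auto simp: \<gamma>_def\<close>)
  note riemann = riemann_sum_uniform[OF _ this]
  have F_approx: "approximable (F t)" for t
  proof -
    have "approximable (\<lambda>x. 1 / poly (poly q [:\<gamma> t:]) (snd x))"
      by (rule approximable_inverse_poly) (use nz1[of _ t] in \<open>simp add: eval2_def\<close>)
    moreover have "approximable (\<lambda>x. 1 / (\<gamma> t - fst x))"
      by (rule approximable_resolvent) (use approximable_coordinates out \<gamma> in auto)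
    ultimately have "approximable (\<lambda>x. 1 / poly (poly q [:\<gamma> t:]) (snd x) * (1 / (\<gamma> t - fst x)) * v t)"
      by (intro approximable_mult approximable_const)
    then show ?thesis
      by (rule approximable_cong) (simp add: F_def eval2_def)
  qed
  have "approximable (\<lambda>x. integral {0..1} (\<lambda>t. F t x))"
  proof (rule approximable_limit)
    fix e :: real assume "e > 0"
    then obtain N where "\<forall>x\<in>X. cmod (integral {0..1} (\<lambda>t. F t x) - (\<Sum>k<N. F (real k / real N) x / of_nat N)) \<le> e"
      using riemann[of e] compact_Times[OF compact_closed_annulus compact_closed_annulus] by blast
    moreover have "approximable (\<lambda>x. \<Sum>k<N. F (real k / real N) x * (1 / of_nat N))"
      by (intro approximable_sum approximable_mult F_approx approximable_const)
    ultimately show "\<exists>g. approximable g \<and> (\<forall>x\<in>X. cmod (integral {0..1} (\<lambda>t. F t x) - g x) \<le> e)"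
      by (intro exI[of _ "\<lambda>x. \<Sum>k<N. F (real k / real N) x * (1 / of_nat N)"]) simp
  qed
  then show ?thesis
    unfolding int .
qed

theorem approximable_inverse:
  assumes q: "\<And>x. x \<in> X \<Longrightarrow> eval2 q x \<noteq> 0"
  shows "approximable (\<lambda>x. 1 / eval2 q x)"
proof -
  have "eval2 q (z, w) \<noteq> 0" if "z \<in> closed_annulus r" "w \<in> closed_annulus r" for z w
    using q that by simp
  then obtain R where R: "R > r" "\<And>z w. z \<in> closed_annulus R \<Longrightarrow> w \<in> closed_annulus r \<Longrightarrow> eval2 q (z, w) \<noteq> 0"
    using zero_free_enlarge[OF r] by blast
  define \<rho> where "\<rho> = (r + R) / 2"
  have "r < \<rho>" "\<rho> < R"
    using R by (auto simp: \<rho>_def)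
  then have \<rho>: "r < \<rho>" "\<rho> < R" "0 < \<rho>" "0 < R" "1 / R < 1 / \<rho>" "1 / \<rho> < 1 / r" "1 / r < 1"
    using r by (auto intro!: divide_strict_left_mono mult_pos_pos)
  define I where "I \<sigma> x = contour_integral (circlepath 0 \<sigma>) (\<lambda>\<zeta>. 1 / eval2 q (\<zeta>, snd x) / (\<zeta> - fst x))" for \<sigma> and x :: "complex \<times> complex"
  have "approximable (I \<rho>)" "approximable (I (1 / \<rho>))"
    unfolding I_def by (rule approximable_cauchy_integral; use \<rho> r R(2) in \<open>auto simp: closed_annulus_def\<close>)+
  then have "approximable (\<lambda>x. 1 / (2 * pi * \<i>) * (I \<rho> x + (- 1) * I (1 / \<rho>) x))"
    by (intro approximable_mult approximable_add approximable_const)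
  then show ?thesis
  proof (rule approximable_cong)
    fix x assume x: "x \<in> X"
    then obtain z w where zw: "x = (z, w)" "z \<in> closed_annulus r" "w \<in> closed_annulus r" by auto
    have "(\<lambda>\<zeta>. 1 / eval2 q (\<zeta>, w)) holomorphic_on {\<zeta>. 1 / R < cmod \<zeta> \<and> cmod \<zeta> < R}"
      by (intro holomorphic_intros holomorphic_on_eval2) (use R(2) zw in \<open>auto simp: closed_annulus_def\<close>)
    then have "I \<rho> x - I (1 / \<rho>) x = 2 * pi * \<i> * (1 / eval2 q x)"
      unfolding I_def zw(1) fst_conv snd_conv
      by (rule Cauchy_formula_annulus) (use \<rho> zw in \<open>auto simp: closed_annulus_def\<close>)
    then show "1 / eval2 q x = 1 / (2 * pi * \<i>) * (I \<rho> x + (- 1) * I (1 / \<rho>) x)"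
      by simp
  qed
qed

lemma laurent_diff: "laurent f F \<Longrightarrow> laurent g G \<Longrightarrow> laurent (\<lambda>x. f x - g x) (F - G)"
proof -
  assume f: "laurent f F" and g: "laurent g G"
  have "laurent (\<lambda>x. - 1) (monomial_op (- 1) 0 0)"
    by (rule laurent.monomial) simp
  from laurent_mult[OF this g] have "laurent (\<lambda>x. - 1 * g x) (monomial_op (- 1) 0 0 o\<^sub>L G)" .
  moreover have "monomial_op (- 1) 0 0 o\<^sub>L G = - G"
  proof (rule blinfun_eqI)
    fix x
    show "(monomial_op (- 1) 0 0 o\<^sub>L G) x = (- G) x"
      using scaleC_of_real[of "- 1" "G x"] by (simp add: monomial_op_apply blinfun.minus_left)
  qed
  ultimately have "laurent (\<lambda>x. - 1 * g x) (- G)" by simp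
  from laurent.add[OF f this, of "\<lambda>x. f x - g x"] show ?thesis by simp
qed

lemma laurent_one: "laurent (\<lambda>x. 1) id_blinfun"
proof -
  have "monomial_op 1 0 0 = id_blinfun"
    by (rule blinfun_eqI) (simp add: monomial_op_apply)
  then show ?thesis
    using laurent.monomial[of "\<lambda>x. 1" 1 0 0] by simp
qed

lemma eval2_bounded:
  obtains K where "\<And>x. x \<in> X \<Longrightarrow> cmod (eval2 p x) \<le> K"
  using approximable_bounded[OF approximable_laurent[OF laurent_eval2[of p]]] by blast

text \<open>
  By the bound for Laurent polynomials, uniform approximants \<open>g\<^sub>n\<close> of \<open>1/q\<close> give a Cauchy sequence of
  operators, and the operators of \<open>q g\<^sub>n - 1\<close> tend to \<open>0\<close>. Hence the limit inverts the operator of \<open>q\<close>, and the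
  bound for \<open>p g\<^sub>n\<close> passes to \<open>p/q\<close>.
\<close>

theorem rational_calculus:
  assumes q: "\<And>x. x \<in> X \<Longrightarrow> eval2 q x \<noteq> 0"
    and M: "\<And>x. x \<in> X \<Longrightarrow> cmod (eval2 p x / eval2 q x) \<le> M"
  shows "invertible_op (eval2_op q T1 T2)" and "norm (rat_op (p, q) T1 T2) \<le> (2 + shields_const r)\<^sup>2 * M"
proof -
  define \<kappa> where "\<kappa> = (2 + shields_const r)\<^sup>2"
  define P Q where "P = eval2_op p T1 T2" and "Q = eval2_op q T1 T2"
  have P: "laurent (eval2 p) P" and Q: "laurent (eval2 q) Q"
    by (simp_all add: P_def Q_def laurent_eval2)
  define \<epsilon> where "\<epsilon> n = 1 / real (Suc n)" for n
  have \<epsilon>0: "\<epsilon> n > 0" for n by (simp add: \<epsilon>_def)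
  have \<epsilon>_lim: "\<epsilon> \<longlonglongrightarrow> 0"
    unfolding \<epsilon>_def by (rule LIMSEQ_Suc[OF lim_1_over_n])
  have "\<forall>n. \<exists>g G. laurent g G \<and> (\<forall>x\<in>X. cmod (1 / eval2 q x - g x) \<le> \<epsilon> n)"
    using approximable_inverse[OF q] \<epsilon>0 unfolding approximable_def by blast
  then obtain g G where G: "\<And>n. laurent (g n) (G n)"
    and g: "\<And>n x. x \<in> X \<Longrightarrow> cmod (1 / eval2 q x - g n x) \<le> \<epsilon> n"
    by metis
  have "Cauchy G"
  proof (rule metric_CauchyI)
    fix e :: real assume e: "e > 0"
    have "(\<lambda>n. \<kappa> * (2 * \<epsilon> n)) \<longlonglongrightarrow> \<kappa> * (2 * 0)"
      by (intro tendsto_intros \<epsilon>_lim)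
    then have "\<forall>\<^sub>F n in sequentially. \<kappa> * (2 * \<epsilon> n) < e"
      using e by (intro order_tendstoD) auto
    then obtain N where N: "\<kappa> * (2 * \<epsilon> N) < e"
      by (auto simp: eventually_sequentially)
    have "dist (G m) (G n) < e" if mn: "m \<ge> N" "n \<ge> N" for m n
    proof -
      have "norm (G m - G n) \<le> \<kappa> * (2 * \<epsilon> N)"
        unfolding \<kappa>_def
      proof (rule laurent_bound[OF laurent_diff[OF G G]])
        fix x assume x: "x \<in> X"
        have "\<epsilon> m \<le> \<epsilon> N" "\<epsilon> n \<le> \<epsilon> N"
          using mn by (auto simp: \<epsilon>_def intro!: divide_left_mono)
        then show "cmod (g m x - g n x) \<le> 2 * \<epsilon> N"
          using g[OF x, of m] g[OF x, of n] norm_triangle_ineq4[of "1 / eval2 q x - g n x" "1 / eval2 q x - g m x"]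
          by simp
      qed
      then show ?thesis
        using N by (simp add: dist_norm)
    qed
    then show "\<exists>N. \<forall>m\<ge>N. \<forall>n\<ge>N. dist (G m) (G n) < e"
      by blast
  qed
  then obtain B where B: "G \<longlonglongrightarrow> B"
    using Cauchy_convergent_iff convergent_def by blast
  obtain K where K: "\<And>x. x \<in> X \<Longrightarrow> cmod (eval2 q x) \<le> K"
    using eval2_bounded by blast
  have close: "cmod (eval2 q x * g n x - 1) \<le> K * \<epsilon> n" if x: "x \<in> X" for x n
  proof -
    have "eval2 q x * g n x - 1 = - (eval2 q x * (1 / eval2 q x - g n x))"
      using q[OF x] by (simp add: algebra_simps)
    then have "cmod (eval2 q x * g n x - 1) = cmod (eval2 q x) * cmod (1 / eval2 q x - g n x)"
      by (simp only: norm_minus_cancel norm_mult)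
    also have "\<dots> \<le> K * \<epsilon> n"
      using K[OF x] g[OF x] order_trans[OF norm_ge_zero K[OF x]] by (intro mult_mono) auto
    finally show ?thesis .
  qed
  have lim0: "(\<lambda>n. \<kappa> * (K * \<epsilon> n)) \<longlonglongrightarrow> 0"
    using tendsto_mult_left[OF tendsto_mult_left[OF \<epsilon>_lim, of K], of \<kappa>] by simp
  have QB: "Q o\<^sub>L B = id_blinfun"
  proof (rule LIMSEQ_unique)
    show "(\<lambda>n. Q o\<^sub>L G n) \<longlonglongrightarrow> (Q o\<^sub>L B)"
      by (intro bounded_bilinear.tendsto[OF bounded_bilinear_blinfun_compose] tendsto_const B)
    show "(\<lambda>n. Q o\<^sub>L G n) \<longlonglongrightarrow> id_blinfun"
    proof (rule LIM_zero_cancel, rule Lim_null_comparison[OF always_eventually lim0], rule allI)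
      fix n
      show "norm ((Q o\<^sub>L G n) - id_blinfun) \<le> \<kappa> * (K * \<epsilon> n)"
        unfolding \<kappa>_def by (rule laurent_bound[OF laurent_diff[OF laurent_mult[OF Q G] laurent_one]]) (rule close)
    qed
  qed
  have BQ: "B o\<^sub>L Q = id_blinfun"
  proof (rule LIMSEQ_unique)
    show "(\<lambda>n. G n o\<^sub>L Q) \<longlonglongrightarrow> (B o\<^sub>L Q)"
      by (intro bounded_bilinear.tendsto[OF bounded_bilinear_blinfun_compose] tendsto_const B)
    show "(\<lambda>n. G n o\<^sub>L Q) \<longlonglongrightarrow> id_blinfun"
    proof (rule LIM_zero_cancel, rule Lim_null_comparison[OF always_eventually lim0], rule allI)
      fix n
      show "norm ((G n o\<^sub>L Q) - id_blinfun) \<le> \<kappa> * (K * \<epsilon> n)"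
        unfolding \<kappa>_def
        by (rule laurent_bound[OF laurent_diff[OF laurent_mult[OF G Q] laurent_one]]) (use close in \<open>simp add: mult.commute\<close>)
    qed
  qed
  have inv: "is_op_inverse Q B"
    by (simp add: is_op_inverse_def QB BQ)
  then show "invertible_op (eval2_op q T1 T2)"
    unfolding invertible_op_def Q_def by blast
  obtain L where L: "\<And>x. x \<in> X \<Longrightarrow> cmod (eval2 p x) \<le> L"
    using eval2_bounded by blast
  have bound: "norm (P o\<^sub>L G n) \<le> \<kappa> * (M + L * \<epsilon> n)" for n
    unfolding \<kappa>_def
  proof (rule laurent_bound[OF laurent_mult[OF P G]])
    fix x assume x: "x \<in> X"
    have "eval2 p x * g n x = eval2 p x / eval2 q x - eval2 p x * (1 / eval2 q x - g n x)"
      by (simp add: algebra_simps)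
    also have "cmod \<dots> \<le> M + L * \<epsilon> n"
      using L[OF x] g[OF x] order_trans[OF norm_ge_zero L[OF x]]
      by (intro order_trans[OF norm_triangle_ineq4] add_mono M x) (auto simp: norm_mult intro!: mult_mono)
    finally show "cmod (eval2 p x * g n x) \<le> M + L * \<epsilon> n" .
  qed
  have "norm (P o\<^sub>L B) \<le> \<kappa> * (M + L * 0)"
  proof (rule LIMSEQ_le)
    show "(\<lambda>n. norm (P o\<^sub>L G n)) \<longlonglongrightarrow> norm (P o\<^sub>L B)"
      by (intro tendsto_norm bounded_bilinear.tendsto[OF bounded_bilinear_blinfun_compose] tendsto_const B)
    show "(\<lambda>n. \<kappa> * (M + L * \<epsilon> n)) \<longlonglongrightarrow> \<kappa> * (M + L * 0)"
      by (intro tendsto_intros \<epsilon>_lim)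
  qed (use bound in blast)
  then show "norm (rat_op (p, q) T1 T2) \<le> (2 + shields_const r)\<^sup>2 * M"
    using op_inverse_eq[OF inv] by (simp add: P_def Q_def \<kappa>_def)
qed

end

theorem theorem3p2:
  fixes r :: real
    and T1 T2 :: "'a :: complex_hilbert_space \<Rightarrow>\<^sub>L 'a"
    and p q :: "complex poly poly"
  assumes "r > 1"
    and "clinear_op T1" and "clinear_op T2"
    and "T1 o\<^sub>L T2 = T2 o\<^sub>L T1"
    and "invertible_op T1" and "invertible_op T2"
    and "norm T1 \<le> r" and "norm T2 \<le> r"
    and "norm (op_inverse T1) \<le> r" and "norm (op_inverse T2) \<le> r"
    and "(p, q) \<in> Rat (closure (annulus r) \<times> closure (annulus r))"
  shows "invertible_op (eval2_op q T1 T2) \<and>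
    norm (rat_op (p, q) T1 T2)
      \<le> (4 + 4 * sqrt ((r\<^sup>2 + 1) / (r\<^sup>2 - 1)) + ((r\<^sup>2 + 1) / (r\<^sup>2 - 1))\<^sup>2)
         * sup_norm (closure (annulus r) \<times> closure (annulus r)) (rat_eval (p, q))"
proof -
  interpret annulus_pair r T1 T2
    by unfold_locales (use assms in auto)
  define M where "M = sup_norm X (rat_eval (p, q))"
  have q: "eval2 q x \<noteq> 0" if "x \<in> X" for x
    using assms(11) that by (auto simp: Rat_def closure_annulus[OF r])
  have "compact ((\<lambda>x. cmod (rat_eval (p, q) x)) ` X)"
  proof (rule compact_continuous_image)
    have "continuous_on X (\<lambda>x. cmod (eval2 p (fst x, snd x) / eval2 q (fst x, snd x)))"
      by (intro continuous_intros) (use q in auto)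
    then show "continuous_on X (\<lambda>x. cmod (rat_eval (p, q) x))"
      by simp
  qed (intro compact_Times compact_closed_annulus)
  then have "bdd_above ((\<lambda>x. cmod (rat_eval (p, q) x)) ` X)"
    by (rule bounded_imp_bdd_above[OF compact_imp_bounded])
  then have M: "cmod (eval2 p x / eval2 q x) \<le> M" if "x \<in> X" for x
    using cSUP_upper[OF that] by (simp add: M_def sup_norm_def)
  have "(1, 1) \<in> X"
    using r by (simp add: closed_annulus_def)
  then have "M \<ge> 0"
    using M norm_ge_zero order_trans by blast
  define s where "s = (r\<^sup>2 + 1) / (r\<^sup>2 - 1)"
  have "r\<^sup>2 > 1" using r by simp
  then have s: "s \<ge> 1"
    by (simp add: s_def)
  have "(2 + shields_const r)\<^sup>2 = 4 + 4 * sqrt s + s"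
    using s by (simp add: shields_const_def s_def[symmetric] power2_sum)
  also have "\<dots> \<le> 4 + 4 * sqrt s + s\<^sup>2"
    using s by (simp add: power2_eq_square)
  finally have "(2 + shields_const r)\<^sup>2 * M \<le> (4 + 4 * sqrt s + s\<^sup>2) * M"
    using \<open>M \<ge> 0\<close> by (rule mult_right_mono)
  then show ?thesis
    using rational_calculus[OF q M] by (auto simp: closure_annulus[OF r] M_def s_def)
qed

end
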